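(* Let $Z\in\mathbb{M}_n$, let $J\in\mathbb{M}_n^+$, and let $\Phi:\mathbb{M}_n\to\mathbb{M}_m$ be a positive linear map. Suppose that there are nonnegative functions $f,g$ on $[0,\infty)$ with $f(t)g(t)=t^2$ for all $t\ge 0$ such that $f(|Z|)\le J$ and $g(|Z^*|)\le J$. Then there exists a unitary $V\in\mathbb{M}_m$ such that $$|\Phi(Z)|\le \Phi(J)\,\#\,V\Phi(J)V^*.$$
   Context: $\mathbb{M}_n$ is the space of complex $n\times n$ matrices and $\mathbb{M}_n^+$ its cone of positive semi-definite matrices. For Hermitian matrices, $A\le B$ means that $B-A$ is positive semi-definite. For $A\in\mathbb{M}_n$, $|A|=(A^*A)^{1/2}$. A linear map $\Phi:\mathbb{M}_n\to\mathbb{M}_m$ is positive if $\Phi(\mathbb{M}_n^+)\subset\mathbb{M}_m^+$. Functions of positive semi-definite matrices are defined by the spectral functional calculus. For $A,B\in\mathbb{M}_m^+$, $A\#B$ denotes the matrix geometric mean: $A\#B=A^{1/2}(A^{-1/2}BA^{-1/2})^{1/2}A^{1/2}$ if $A,B$ are invertible, and $A\#B=\lim_{\varepsilon\downarrow0}(A+\varepsilon I)\#(B+\varepsilon I)$ in general; equivalently, $A\#B$ is the largest Hermitian $X$ such that $\begin{pmatrix} A & X \\ X & B \end{pmatrix}\ge0$. *)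

theory Defs
  imports "HOL-Analysis.Analysis"
begin

text \<open>
  Complex square matrices of order \<open>n\<close> are elements of \<open>complex^'n^'n\<close> with \<open>n = CARD('n)\<close>;
  the matrix product is \<open>**\<close> and the scalar matrix \<open>c I\<close> is \<open>mat c\<close>.
\<close>

definition adj :: "complex^'n^'n \<Rightarrow> complex^'n^'n" where
  "adj A = (\<chi> i j. cnj (A $ j $ i))"

definition hermitian :: "complex^'n^'n \<Rightarrow> bool" where
  "hermitian A \<longleftrightarrow> adj A = A"

definition unitary :: "complex^'n^'n \<Rightarrow> bool" where
  "unitary U \<longleftrightarrow> adj U ** U = mat 1 \<and> U ** adj U = mat 1"

text \<open>The quadratic form of a Hermitian matrix is real, so taking real parts loses nothing.\<close>

definition psd :: "complex^'n^'n \<Rightarrow> bool" where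
  "psd A \<longleftrightarrow> hermitian A \<and> (\<forall>x. 0 \<le> Re (\<Sum>i\<in>UNIV. cnj (x $ i) * (A *v x) $ i))"

definition loewner_le :: "complex^'n^'n \<Rightarrow> complex^'n^'n \<Rightarrow> bool" (infix "\<preceq>\<^sub>L" 50) where
  "A \<preceq>\<^sub>L B \<longleftrightarrow> hermitian A \<and> hermitian B \<and> psd (B - A)"

definition real_diag :: "('n \<Rightarrow> real) \<Rightarrow> complex^'n^'n" where
  "real_diag d = (\<chi> i j. if i = j then complex_of_real (d i) else 0)"

text \<open>
  Spectral functional calculus: \<open>f(U diag(d) U\<^sup>*) = U diag(f \<circ> d) U\<^sup>*\<close>. The value does not depend
  on the chosen unitary diagonalization (\<open>hfun_eq\<close> below). It is meaningful
  only for Hermitian \<open>A\<close>, and involves only the values of \<open>f\<close> at eigenvalues of \<open>A\<close>.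
\<close>

definition hfun :: "(real \<Rightarrow> real) \<Rightarrow> complex^'n^'n \<Rightarrow> complex^'n^'n" where
  "hfun f A = (THE B. \<exists>U d. unitary U \<and> A = U ** real_diag d ** adj U
                          \<and> B = U ** real_diag (\<lambda>i. f (d i)) ** adj U)"

definition mat_abs :: "complex^'n^'n \<Rightarrow> complex^'n^'n" where
  "mat_abs A = hfun sqrt (adj A ** A)"

text \<open>\<open>A\<^sup>1\<^sup>/\<^sup>2 (A\<^sup>-\<^sup>1\<^sup>/\<^sup>2 B A\<^sup>-\<^sup>1\<^sup>/\<^sup>2)\<^sup>1\<^sup>/\<^sup>2 A\<^sup>1\<^sup>/\<^sup>2\<close>, for positive definite \<open>A\<close> and \<open>B\<close>.\<close>

definition geo_mean_inv :: "complex^'n^'n \<Rightarrow> complex^'n^'n \<Rightarrow> complex^'n^'n" where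
  "geo_mean_inv A B =
     (let S = hfun sqrt A; T = hfun (\<lambda>t. 1 / sqrt t) A
      in S ** hfun sqrt (T ** B ** T) ** S)"

definition geo_mean :: "complex^'n^'n \<Rightarrow> complex^'n^'n \<Rightarrow> complex^'n^'n" (infixl "\<sharp>" 70) where
  "A \<sharp> B =
     (if invertible A \<and> invertible B then geo_mean_inv A B
      else Lim (at_right 0)
             (\<lambda>\<epsilon>::real. geo_mean_inv (A + mat (complex_of_real \<epsilon>)) (B + mat (complex_of_real \<epsilon>))))"

definition cscale :: "complex \<Rightarrow> complex^'n^'n \<Rightarrow> complex^'n^'n" where
  "cscale c A = (\<chi> i j. c * A $ i $ j)"

text \<open>
  Complex linearity; the constant \<open>linear\<close> of HOL-Analysis would only mean real linearity.
\<close>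

definition positive_linear_map :: "(complex^'n^'n \<Rightarrow> complex^'m^'m) \<Rightarrow> bool" where
  "positive_linear_map \<Phi> \<longleftrightarrow>
     Vector_Spaces.linear cscale cscale \<Phi> \<and> (\<forall>A. psd A \<longrightarrow> psd (\<Phi> A))"

lemma vector_space_cscale: "vector_space cscale"
  by unfold_locales (auto simp: cscale_def vec_eq_iff algebra_simps)

lemma linear_cscale_iff:
  "Vector_Spaces.linear cscale cscale \<Phi> \<longleftrightarrow>
     (\<forall>A B. \<Phi> (A + B) = \<Phi> A + \<Phi> B) \<and> (\<forall>c A. \<Phi> (cscale c A) = cscale c (\<Phi> A))"
  by (simp add: Vector_Spaces.linear_iff vector_space_cscale)

lemma real_diag_mult_left: "(real_diag d ** A) $ i $ j = of_real (d i) * A $ i $ j"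
  by (simp add: real_diag_def matrix_matrix_mult_def if_distrib[of "\<lambda>x. x * _"] cong: if_cong)

lemma real_diag_mult_right: "(A ** real_diag d) $ i $ j = A $ i $ j * of_real (d j)"
  by (simp add: real_diag_def matrix_matrix_mult_def if_distrib[of "\<lambda>x. _ * x"] cong: if_cong)

lemma real_diag_intertwine:
  assumes "S ** real_diag d = real_diag e ** S"
  shows "S ** real_diag (\<lambda>i. f (d i)) = real_diag (\<lambda>i. f (e i)) ** S"
proof -
  have "S $ i $ j * of_real (f (d j)) = of_real (f (e i)) * S $ i $ j" for i j
  proof -
    have "S $ i $ j * of_real (d j) = of_real (e i) * S $ i $ j"
      using assms by (metis real_diag_mult_left real_diag_mult_right)
    then show ?thesis by (cases "S $ i $ j = 0") auto
  qed
  then show ?thesis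
    by (simp add: vec_eq_iff real_diag_mult_left real_diag_mult_right)
qed

lemma hfun_eq:
  assumes U: "unitary U" and A: "A = U ** real_diag d ** adj U"
  shows "hfun f A = U ** real_diag (\<lambda>i. f (d i)) ** adj U"
  unfolding hfun_def
proof (rule the_equality)
  show "\<exists>U' d'. unitary U' \<and> A = U' ** real_diag d' ** adj U' \<and>
          U ** real_diag (\<lambda>i. f (d i)) ** adj U = U' ** real_diag (\<lambda>i. f (d' i)) ** adj U'"
    using U A by blast
next
  fix B
  assume "\<exists>W e. unitary W \<and> A = W ** real_diag e ** adj W
               \<and> B = W ** real_diag (\<lambda>i. f (e i)) ** adj W"
  then obtain W e where W: "unitary W" and AW: "A = W ** real_diag e ** adj W"
    and B: "B = W ** real_diag (\<lambda>i. f (e i)) ** adj W"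
    by blast
  have cancel: "adj U ** (U ** X) = X" "U ** (adj U ** X) = X"
    "adj W ** (W ** X) = X" "W ** (adj W ** X) = X" for X
    using U W by (simp_all add: unitary_def matrix_mul_assoc)
  have UW: "U ** adj U = mat 1" "adj U ** U = mat 1" "W ** adj W = mat 1"
    using U W by (simp_all add: unitary_def)
  have "U ** (real_diag d ** adj U) = W ** (real_diag e ** adj W)"
    using A AW by (simp add: matrix_mul_assoc)
  then have "adj W ** (U ** (real_diag d ** adj U)) ** U = adj W ** (W ** (real_diag e ** adj W)) ** U"
    by simp
  then have "(adj W ** U) ** real_diag d = real_diag e ** (adj W ** U)"
    by (simp add: matrix_mul_assoc[symmetric] cancel UW)
  then have "(adj W ** U) ** real_diag (\<lambda>i. f (d i)) = real_diag (\<lambda>i. f (e i)) ** (adj W ** U)"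
    by (rule real_diag_intertwine)
  then have "W ** ((adj W ** U) ** real_diag (\<lambda>i. f (d i))) ** adj U
           = W ** (real_diag (\<lambda>i. f (e i)) ** (adj W ** U)) ** adj U"
    by simp
  then show "B = U ** real_diag (\<lambda>i. f (d i)) ** adj U"
    unfolding B by (simp add: matrix_mul_assoc[symmetric] cancel UW)
qed

end

theory Submission
  imports Defs
begin

text \<open>
  Call \<open>(A, X, B)\<close> block positive if the matrix with rows \<open>(A, X)\<close> and \<open>(X\<^sup>*, B)\<close> is positive
  semidefinite. The proof carries one such block matrix from the hypotheses to the conclusion.

  With a singular value decomposition \<open>Z = W D U\<^sup>*\<close>, the triple
  \<open>(g(|Z\<^sup>*|), Z, f(|Z|))\<close> is unitarily equivalent to \<open>(g(D), D, f(D))\<close>, a direct sum of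
  two-by-two matrices of determinant \<open>f(t) g(t) - t\<^sup>2 = 0\<close>. Hence it is block positive
  (\<open>block_pos_of_factorization\<close>), and enlarging the diagonal blocks makes \<open>(J, Z, J)\<close> block positive.

  A positive map need not preserve positivity of general block matrices, but it does for those with
  equal diagonal blocks (\<open>positive_map_block_pos\<close>). Conjugation by \<open>J\<^sup>-\<^sup>1\<^sup>/\<^sup>2\<close> reduces this to \<open>J = I\<close>
  and a contraction \<open>C\<close> in place of \<open>Z\<close> when \<open>J\<close> is invertible, and the
  general case follows by a limit; a contraction is the average of two unitaries; and a unitary
  is \<open>\<Sum> c\<^sub>k P\<^sub>k\<close> with \<open>|c\<^sub>k| = 1\<close>, \<open>P\<^sub>k \<ge> 0\<close> and \<open>\<Sum> P\<^sub>k = I\<close>. As \<open>\<Phi>(P\<^sub>k) \<ge> 0\<close>, each triple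
  \<open>(\<Phi>(P\<^sub>k), c\<^sub>k \<Phi>(P\<^sub>k), \<Phi>(P\<^sub>k))\<close> is block positive, and so is their sum. This is the argument
  behind the Russo--Dye theorem.

  Finally, a polar decomposition \<open>\<Phi>(Z) = V\<^sup>* |\<Phi>(Z)|\<close> turns \<open>(\<Phi>(J), \<Phi>(Z), \<Phi>(J))\<close> into the block
  positive triple \<open>(V \<Phi>(J) V\<^sup>*, |\<Phi>(Z)|, \<Phi>(J))\<close> (\<open>block_pos_polar\<close>), whose middle term is Hermitian.
  The inequality follows because \<open>A # B\<close> dominates every Hermitian \<open>M\<close> for which \<open>(A, M, B)\<close> is
  block positive (\<open>block_pos_le_geo_mean\<close>).
\<close>

section \<open>The Hermitian inner product and adjoints\<close>

definition cdot :: "complex^'n \<Rightarrow> complex^'n \<Rightarrow> complex" where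
  "cdot x y = (\<Sum>i\<in>UNIV. cnj (x $ i) * y $ i)"

text \<open>
  The inner product on \<open>complex^'n\<close> as a Euclidean space is the real part of the Hermitian one.
  Since \<open>adj\<close> is also the adjoint for this real inner product, quadratic forms can be
  handled with \<open>\<bullet>\<close> alone; \<open>cdot\<close> is needed only where complex orthogonality matters.
\<close>

lemma inner_eq_Re_cdot: "x \<bullet> y = Re (cdot x y)" for x y :: "complex^'n"
  by (simp add: cdot_def inner_vec_def inner_complex_def Re_sum)

lemma cdot_self: "cdot x x = complex_of_real (x \<bullet> x)"
  by (simp add: cdot_def inner_vec_def complex_eq_iff Im_sum Re_sum inner_complex_def)

lemma cdot_add: "cdot x (y + z) = cdot x y + cdot x z"
  and cdot_scaleR: "cdot x (r *\<^sub>R y) = of_real r * cdot x y"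
  and cdot_zero: "cdot x 0 = 0"
  by (simp_all add: cdot_def algebra_simps sum.distrib sum_distrib_left scaleR_conv_of_real[where 'a=complex])

lemma cdot_commute: "cdot x y = cnj (cdot y x)"
  by (simp add: cdot_def mult.commute)

lemma cdot_matrix: "cdot x (A *v y) = cdot (adj A *v x) y"
proof -
  have "cdot x (A *v y) = (\<Sum>i\<in>UNIV. \<Sum>j\<in>UNIV. cnj (x $ i) * (A $ i $ j * y $ j))"
    by (simp add: cdot_def matrix_vector_mult_def sum_distrib_left)
  also have "\<dots> = (\<Sum>j\<in>UNIV. \<Sum>i\<in>UNIV. cnj (x $ i) * (A $ i $ j * y $ j))"
    by (rule sum.swap)
  also have "\<dots> = cdot (adj A *v x) y"
    by (simp add: cdot_def matrix_vector_mult_def adj_def sum_distrib_left sum_distrib_right mult_ac)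
  finally show ?thesis .
qed

lemma inner_matrix: "x \<bullet> (A *v y) = (adj A *v x) \<bullet> y" for x y :: "complex^'n"
  by (simp add: inner_eq_Re_cdot cdot_matrix)

lemma adj_adj [simp]: "adj (adj A) = A"
  by (simp add: adj_def vec_eq_iff)

lemma adj_mult: "adj (A ** B) = adj B ** adj A"
  by (simp add: adj_def matrix_matrix_mult_def vec_eq_iff mult.commute)

lemma adj_add: "adj (A + B) = adj A + adj B"
  and adj_diff: "adj (A - B) = adj A - adj B"
  and adj_cscale: "adj (cscale c A) = cscale (cnj c) (adj A)"
  by (simp_all add: adj_def cscale_def vec_eq_iff)

lemma adj_real_diag [simp]: "adj (real_diag d) = real_diag d"
  by (simp add: adj_def real_diag_def vec_eq_iff)

lemma adj_mat_real [simp]: "adj (mat (complex_of_real r)) = mat (complex_of_real r)"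
  by (simp add: adj_def mat_def vec_eq_iff)

lemma hermitian_inner:
  assumes "hermitian A"
  shows "(A *v x) \<bullet> y = x \<bullet> (A *v y)"
  using assms by (simp add: inner_matrix hermitian_def)

lemma psd_iff: "psd A \<longleftrightarrow> hermitian A \<and> (\<forall>x. 0 \<le> x \<bullet> (A *v x))"
  by (simp add: psd_def inner_eq_Re_cdot cdot_def)

lemma cscale_mult_left: "cscale c A ** B = cscale c (A ** B)"
  and cscale_mult_right: "A ** cscale c B = cscale c (A ** B)"
  by (simp_all add: cscale_def matrix_matrix_mult_def vec_eq_iff sum_distrib_left mult_ac)

lemma cscale_vec: "cscale c A *v x = A *v (c *s x)"
  by (simp add: cscale_def matrix_vector_mult_def vec_eq_iff mult_ac)

lemma cscale_real: "cscale (complex_of_real r) A = r *\<^sub>R A"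
  unfolding cscale_def vec_eq_iff by (simp add: scaleR_conv_of_real[where 'a=complex])

lemma mat_real_vec: "mat (complex_of_real r) *v x = r *\<^sub>R x"
  unfolding vec_eq_iff mat_def matrix_vector_mult_def
  by (simp add: if_distrib[of "\<lambda>x. x * _"] scaleR_conv_of_real[where 'a=complex] cong: if_cong)

lemma matrix_vec_scaleR: "A *v (r *\<^sub>R x) = r *\<^sub>R (A *v x)" for A :: "complex^'n^'m"
  unfolding vec_eq_iff matrix_vector_mult_def
  by (simp add: scaleR_right.sum scaleR_sum_right)

lemma scaleR_matrix_vec: "(r *\<^sub>R A) *v x = r *\<^sub>R (A *v x)" for A :: "complex^'n^'m"
  unfolding vec_eq_iff matrix_vector_mult_def
  by (simp add: scaleR_right.sum scaleR_sum_right)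

lemma matrix_mult_add_left: "(A + B) ** C = A ** C + B ** C"
  and matrix_mult_add_right: "C ** (A + B) = C ** A + C ** B"
  and matrix_mult_diff_left: "(A - B) ** C = A ** C - B ** C"
  and matrix_mult_diff_right: "C ** (A - B) = C ** A - C ** B"
  for A B C :: "complex^'n^'n"
  by (simp_all add: matrix_matrix_mult_def vec_eq_iff algebra_simps sum.distrib sum_subtractf)

lemma real_diag_mult: "real_diag d ** real_diag e = real_diag (\<lambda>i. d i * e i)"
  unfolding vec_eq_iff real_diag_mult_left by (simp add: real_diag_def)

lemma real_diag_vec: "(real_diag d *v x) $ i = d i *\<^sub>R x $ i"
  by (simp add: real_diag_def matrix_vector_mult_def scaleR_conv_of_real if_distrib[of "\<lambda>x. x * _"] cong: if_cong)

lemma real_diag_const: "real_diag (\<lambda>i. r) = mat (complex_of_real r)"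
  by (simp add: real_diag_def mat_def)

lemma unitary_cancel:
  assumes "unitary U"
  shows "U ** adj U = mat 1" "adj U ** U = mat 1"
    "adj U ** (U ** X) = X" "U ** (adj U ** X) = X"
    "adj U *v (U *v x) = x" "U *v (adj U *v x) = x"
  using assms by (simp_all add: unitary_def matrix_mul_assoc matrix_vector_mul_assoc)

lemma unitary_adj: "unitary U \<Longrightarrow> unitary (adj U)"
  by (simp add: unitary_def)

lemma unitary_mult: "unitary U \<Longrightarrow> unitary V \<Longrightarrow> unitary (U ** V)"
  unfolding unitary_def adj_mult
  by (metis matrix_mul_assoc matrix_mul_rid)

section \<open>Orthonormal families and the spectral theorem\<close>

definition orthonormal_on :: "'n set \<Rightarrow> ('n \<Rightarrow> complex^'n) \<Rightarrow> bool" where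
  "orthonormal_on T v \<longleftrightarrow> (\<forall>i\<in>T. \<forall>j\<in>T. cdot (v i) (v j) = (if i = j then 1 else 0))"

text \<open>
  The linear map \<open>x \<mapsto> (\<langle>v\<^sub>i, x\<rangle>)\<close>, padded by zeros for \<open>i \<notin> T\<close>, misses a basis vector, so as an endomorphism of a
  finite-dimensional space it has a kernel.
\<close>

lemma ex_orthogonal_vector:
  fixes v :: "'n \<Rightarrow> complex^'n"
  assumes "T \<noteq> UNIV"
  shows "\<exists>x. x \<noteq> 0 \<and> (\<forall>j\<in>T. cdot (v j) x = 0)"
proof -
  obtain k where k: "k \<notin> T" using assms by auto
  define A :: "complex^'n^'n" where "A = (\<chi> i j. if i \<in> T then cnj (v i $ j) else 0)"
  have A: "(A *v x) $ i = (if i \<in> T then cdot (v i) x else 0)" for x i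
    by (simp add: A_def matrix_vector_mult_def cdot_def)
  have "\<not> surj ((*v) A)"
  proof
    assume "surj ((*v) A)"
    then obtain x where "axis k 1 = A *v x" by (metis surjD)
    then have "(axis k 1 :: complex^'n) $ k = (A *v x) $ k" by simp
    then show False using k by (simp add: A axis_def)
  qed
  then have "\<not> (\<exists>B. B ** A = mat 1)"
    using matrix_right_invertible_surjective[of A] matrix_left_right_inverse[of A] by blast
  then obtain x where "A *v x = 0" "x \<noteq> 0"
    unfolding matrix_left_invertible_ker by blast
  then show ?thesis using A by (metis zero_index)
qed

lemma orthonormal_on_insert:
  assumes "orthonormal_on T v" "i \<notin> T" "\<forall>j\<in>T. cdot (v j) x = 0" "x \<bullet> x = 1"
  shows "orthonormal_on (insert i T) (v(i := x))"
proof -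
  have "cdot x x = 1" using assms(4) by (simp add: cdot_self)
  moreover have "\<forall>j\<in>T. cdot x (v j) = 0"
    using assms(3) cdot_commute[of x "v _"] by (metis complex_cnj_zero)
  ultimately show ?thesis using assms(1-3) unfolding orthonormal_on_def by auto
qed

lemma orthonormal_family_unitary:
  assumes "orthonormal_on UNIV v"
  shows "unitary (\<chi> r c. v c $ r)"
proof -
  have "adj (\<chi> r c. v c $ r) ** (\<chi> r c. v c $ r) = mat 1"
    using assms
    by (simp add: orthonormal_on_def cdot_def vec_eq_iff matrix_matrix_mult_def adj_def mat_def)
  then show ?thesis
    using matrix_left_right_inverse[of "adj (\<chi> r c. v c $ r)" "\<chi> r c. v c $ r"]
    by (simp add: unitary_def)
qed

text \<open>
  A maximiser \<open>v\<close> of the Rayleigh quotient on the unit sphere of the subspace is an eigenvector: for the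
  maximum \<open>l\<close>, the form \<open>l |x|\<^sup>2 - \<langle>x, H x\<rangle>\<close> is nonnegative and vanishes at \<open>v\<close>, and its first
  variation at \<open>v\<close> in the direction \<open>w = l v - H v\<close>, which lies in the subspace by invariance,
  forces \<open>w = 0\<close>.
\<close>

lemma hermitian_eigenvector_in_subspace:
  assumes H: "hermitian H" and S: "subspace S" "\<And>x. x \<in> S \<Longrightarrow> H *v x \<in> S"
    and ne: "y \<in> S" "y \<noteq> 0"
  obtains v l where "v \<in> S" "v \<bullet> v = 1" "H *v v = (l::real) *\<^sub>R v"
proof -
  let ?K = "S \<inter> sphere 0 1"
  have "compact ?K"
    using closed_subspace[OF S(1)] by (simp add: closed_Int_compact)
  moreover have "(1 / norm y) *\<^sub>R y \<in> ?K"
    using ne S(1) by (simp add: subspace_scale)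
  moreover have "continuous_on ?K (\<lambda>x. x \<bullet> (H *v x))"
    unfolding matrix_vector_mult_def by (intro continuous_intros)
  ultimately obtain v where v: "v \<in> ?K" and
    max: "\<And>x. x \<in> ?K \<Longrightarrow> x \<bullet> (H *v x) \<le> v \<bullet> (H *v v)"
    using continuous_attains_sup[of ?K "\<lambda>x. x \<bullet> (H *v x)"] by (metis empty_iff)
  define l where "l = v \<bullet> (H *v v)"
  have v1: "v \<bullet> v = 1" using v by (simp add: dot_square_norm)
  define w where "w = l *\<^sub>R v - H *v v"
  have wS: "w \<in> S"
    using v S by (auto simp: w_def intro!: subspace_diff subspace_scale)
  have rayleigh: "x \<bullet> (H *v x) \<le> l * (x \<bullet> x)" if "x \<in> S" for x
  proof (cases "x = 0")
    case False
    then have "(1 / norm x) *\<^sub>R x \<in> ?K" using that S(1) by (simp add: subspace_scale)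
    from max[OF this] have "(x \<bullet> (H *v x)) / (norm x)\<^sup>2 \<le> l"
      by (simp add: matrix_vec_scaleR l_def power2_eq_square)
    then show ?thesis using False by (simp add: dot_square_norm field_simps)
  qed simp
  define c where "c = l * (w \<bullet> w) - w \<bullet> (H *v w)"
  have c0: "c \<ge> 0" using rayleigh[OF wS] by (simp add: c_def)
  have quad: "0 \<le> 2 * t * (w \<bullet> w) + t\<^sup>2 * c" for t
  proof -
    have "v + t *\<^sub>R w \<in> S" using v wS S(1) by (simp add: subspace_add subspace_scale)
    from rayleigh[OF this]
    have "0 \<le> l * ((v + t *\<^sub>R w) \<bullet> (v + t *\<^sub>R w)) - (v + t *\<^sub>R w) \<bullet> (H *v (v + t *\<^sub>R w))"
      by simp
    also have "\<dots> = 2 * t * (w \<bullet> (l *\<^sub>R v - H *v v)) + t\<^sup>2 * c"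
      using v1 l_def hermitian_inner[OF H, of v w]
      by (simp add: c_def matrix_vec_scaleR matrix_vector_right_distrib inner_add_left inner_add_right
          inner_diff_right inner_commute algebra_simps power2_eq_square)
    finally show ?thesis by (simp add: w_def)
  qed
  have "w \<bullet> w = 0"
  proof (rule ccontr)
    assume "w \<bullet> w \<noteq> 0"
    then have p: "w \<bullet> w > 0" by (simp add: inner_gt_zero_iff)
    \<comment> \<open>in place of the minimiser \<open>- (w \<bullet> w) / c\<close> of the quadratic; the \<open>+ 1\<close> covers \<open>c = 0\<close>\<close>
    define t where "t = - (w \<bullet> w) / (c + 1)"
    have "2 * t * (w \<bullet> w) + t\<^sup>2 * c = - ((w \<bullet> w)\<^sup>2 * (c + 2)) / (c + 1)\<^sup>2"
      using c0 by (simp add: t_def power2_eq_square divide_simps) (simp add: algebra_simps)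
    also have "\<dots> < 0" using p c0 by (simp add: divide_neg_pos)
    finally show False using quad[of t] by simp
  qed
  then have "H *v v = l *\<^sub>R v" by (simp add: w_def)
  then show thesis using that v v1 by blast
qed

text \<open>
  An orthonormal family of joint eigenvectors is extended one index at a time. Its orthogonal
  complement \<open>S\<close> is invariant under both matrices. An eigenspace of \<open>A\<close> in \<open>S\<close> is invariant under \<open>B\<close>
  by commutation, so it contains an eigenvector of \<open>B\<close>. Treating a pair at once covers the
  real and imaginary parts of a unitary matrix as well as a single Hermitian matrix.
\<close>

theorem commuting_hermitian_diagonalization:
  fixes A B :: "complex^'n^'n"
  assumes A: "hermitian A" and B: "hermitian B" and AB: "A ** B = B ** A"
  obtains U a b where "unitary U" "A = U ** real_diag a ** adj U" "B = U ** real_diag b ** adj U"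
proof -
  have comm: "A *v (B *v x) = B *v (A *v x)" for x
    by (simp add: matrix_vector_mul_assoc AB)
  have "\<exists>v a b. orthonormal_on T v \<and> (\<forall>i\<in>T. A *v v i = (a i::real) *\<^sub>R v i \<and> B *v v i = (b i::real) *\<^sub>R v i)"
    for T :: "'n set"
    using finite[of T]
  proof (induction T rule: finite_induct)
    case empty
    then show ?case by (simp add: orthonormal_on_def)
  next
    case (insert i T)
    then obtain v a b where on: "orthonormal_on T v"
      and ev: "\<And>j. j \<in> T \<Longrightarrow> A *v v j = (a j::real) *\<^sub>R v j"
              "\<And>j. j \<in> T \<Longrightarrow> B *v v j = (b j::real) *\<^sub>R v j"
      by blast
    define S where "S = {x. \<forall>j\<in>T. cdot (v j) x = 0}"
    have S: "subspace S"
      by (simp add: S_def subspace_def cdot_add cdot_scaleR cdot_zero)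
    have inv: "C *v x \<in> S" if "x \<in> S" and C: "hermitian C"
      and evC: "\<And>j. j \<in> T \<Longrightarrow> C *v v j = (c j::real) *\<^sub>R v j" for C c x
    proof -
      have "cdot (v j) (C *v x) = 0" if "j \<in> T" for j
      proof -
        have "cdot (v j) (C *v x) = cdot (c j *\<^sub>R v j) x"
          using C evC[OF that] by (simp add: cdot_matrix hermitian_def)
        also have "\<dots> = 0"
          using \<open>x \<in> S\<close> that cdot_commute[of x "v j"] cdot_commute[of "c j *\<^sub>R v j" x]
          by (simp add: S_def cdot_scaleR)
        finally show ?thesis .
      qed
      then show ?thesis by (simp add: S_def)
    qed
    obtain y where y: "y \<in> S" "y \<noteq> 0"
      using ex_orthogonal_vector[of T v] insert.hyps by (auto simp: S_def)
    obtain p l where p: "p \<in> S" "p \<bullet> p = 1" "A *v p = (l::real) *\<^sub>R p"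
      using hermitian_eigenvector_in_subspace[OF A S _ y] inv[OF _ A ev(1)] by blast
    let ?E = "S \<inter> {x. A *v x = l *\<^sub>R x}"
    have "subspace ?E"
      using S by (simp add: subspace_def matrix_vector_right_distrib matrix_vec_scaleR scaleR_add_right)
    moreover have "B *v x \<in> ?E" if "x \<in> ?E" for x
      using that inv[OF _ B ev(2)] by (simp add: comm matrix_vec_scaleR)
    moreover have "p \<in> ?E" "p \<noteq> 0" using p by auto
    ultimately obtain q m where q: "q \<in> ?E" "q \<bullet> q = 1" "B *v q = (m::real) *\<^sub>R q"
      using hermitian_eigenvector_in_subspace[OF B] by blast
    have "orthonormal_on (insert i T) (v(i := q))"
      using orthonormal_on_insert[OF on] insert.hyps q by (simp add: S_def)
    moreover have "\<forall>j\<in>insert i T. A *v (v(i := q)) j = (a(i := l)) j *\<^sub>R (v(i := q)) j \<and>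
        B *v (v(i := q)) j = (b(i := m)) j *\<^sub>R (v(i := q)) j"
      using q ev insert.hyps by auto
    ultimately show ?case by blast
  qed
  from this[of UNIV] obtain v a b where on: "orthonormal_on UNIV v"
    and ev: "\<And>j. A *v v j = (a j::real) *\<^sub>R v j" "\<And>j. B *v v j = (b j::real) *\<^sub>R v j"
    by auto
  define U where "U = (\<chi> r c. v c $ r)"
  have U: "unitary U" unfolding U_def by (rule orthonormal_family_unitary[OF on])
  have diag: "C = U ** real_diag c ** adj U" if "\<And>j. C *v v j = (c j::real) *\<^sub>R v j" for C c
  proof -
    have "(C ** U) $ r $ k = (C *v v k) $ r" for r k
      by (simp add: matrix_matrix_mult_def matrix_vector_mult_def U_def)
    then have "C ** U = U ** real_diag c"
      unfolding vec_eq_iff real_diag_mult_right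
      by (simp add: that U_def scaleR_conv_of_real[where 'a=complex] mult.commute)
    then show ?thesis
      by (metis U matrix_mul_assoc matrix_mul_rid unitary_cancel(1))
  qed
  show thesis using that[OF U diag[OF ev(1)] diag[OF ev(2)]] .
qed

corollary hermitian_diagonalization:
  assumes "hermitian A"
  obtains U d where "unitary U" "A = U ** real_diag d ** adj U"
  by (rule commuting_hermitian_diagonalization[OF assms assms refl]) (rule that)

section \<open>Singular value decomposition and the matrix modulus\<close>

lemma orthonormal_on_extend:
  fixes v :: "'n \<Rightarrow> complex^'n"
  assumes "orthonormal_on T v"
  obtains w where "orthonormal_on UNIV w" "\<And>i. i \<in> T \<Longrightarrow> w i = v i"
proof -
  have "\<exists>w. orthonormal_on (T \<union> F) w \<and> (\<forall>i\<in>T. w i = v i)" for F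
    using finite[of F]
  proof (induction F rule: finite_induct)
    case empty
    then show ?case using assms by auto
  next
    case (insert i F)
    then obtain w where w: "orthonormal_on (T \<union> F) w" "\<forall>i\<in>T. w i = v i" by blast
    show ?case
    proof (cases "i \<in> T \<union> F")
      case True
      then have "T \<union> insert i F = T \<union> F" by auto
      then show ?thesis using w by auto
    next
      case False
      then obtain x where x: "x \<noteq> 0" "\<forall>j\<in>T \<union> F. cdot (w j) x = 0"
        using ex_orthogonal_vector[of "T \<union> F" w] by auto
      define y where "y = (1 / norm x) *\<^sub>R x"
      have "y \<bullet> y = 1" using x(1) by (simp add: y_def dot_square_norm power2_eq_square)
      moreover have "\<forall>j\<in>T \<union> F. cdot (w j) y = 0" using x(2) by (simp add: y_def cdot_scaleR)
      ultimately have "orthonormal_on (insert i (T \<union> F)) (w(i := y))"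
        using orthonormal_on_insert[OF w(1) False] by simp
      moreover have "insert i (T \<union> F) = T \<union> insert i F" by auto
      moreover have "\<forall>j\<in>T. (w(i := y)) j = v j" using w(2) False by auto
      ultimately show ?thesis by metis
    qed
  qed
  from this[of UNIV] show thesis using that by auto
qed

lemma inner_sandwich:
  "x \<bullet> ((W ** real_diag d ** adj U) *v y) = (\<Sum>i\<in>UNIV. d i * ((adj W *v x) $ i \<bullet> (adj U *v y) $ i))"
proof -
  have "x \<bullet> ((W ** real_diag d ** adj U) *v y) = (adj W *v x) \<bullet> (real_diag d *v (adj U *v y))"
    by (simp add: matrix_vector_mul_assoc[symmetric] inner_matrix)
  then show ?thesis by (simp add: inner_vec_def real_diag_vec)
qed

lemma sandwich_mult:
  assumes "unitary U"
  shows "(V ** real_diag d ** adj U) ** (U ** real_diag e ** W) = V ** real_diag (\<lambda>i. d i * e i) ** W"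
proof -
  have "(V ** real_diag d ** adj U) ** (U ** real_diag e ** W)
      = V ** ((real_diag d ** (adj U ** U) ** real_diag e)) ** W"
    by (simp add: matrix_mul_assoc)
  then show ?thesis using assms by (simp add: unitary_cancel real_diag_mult)
qed

lemma adj_sandwich: "adj (W ** real_diag d ** adj U) = U ** real_diag d ** adj W"
  by (simp add: adj_mult matrix_mul_assoc)

lemma hermitian_sandwich: "hermitian (U ** real_diag d ** adj U)"
  by (simp add: hermitian_def adj_sandwich)

lemma psd_sandwich: "(\<And>i. 0 \<le> d i) \<Longrightarrow> psd (U ** real_diag d ** adj U)"
  by (auto simp: psd_iff hermitian_sandwich inner_sandwich intro!: sum_nonneg)

lemma sandwich_axis:
  assumes "unitary U"
  shows "(W ** real_diag d ** adj U) *v (U *v axis i 1) = d i *\<^sub>R (W *v axis i 1)"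
proof -
  have "real_diag d *v (axis i 1 :: complex^'a) = d i *\<^sub>R axis i 1"
    unfolding vec_eq_iff real_diag_vec by (simp add: axis_def)
  then show ?thesis
    using assms by (simp add: matrix_vector_mul_assoc[symmetric] unitary_cancel matrix_vec_scaleR)
qed

lemma unitary_inner: "unitary U \<Longrightarrow> (U *v x) \<bullet> (U *v y) = x \<bullet> y"
  by (simp add: inner_matrix unitary_cancel)

lemma inner_axis_self: "(axis i 1 :: complex^'n) \<bullet> axis i 1 = 1"
  by (simp add: inner_axis)

lemma psd_diagonalization:
  assumes "psd A"
  obtains U d where "unitary U" "A = U ** real_diag d ** adj U" "\<And>i. 0 \<le> d i"
proof -
  obtain U d where U: "unitary U" and A: "A = U ** real_diag d ** adj U"
    using assms by (auto simp: psd_def elim: hermitian_diagonalization)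
  have "0 \<le> d i" for i
  proof -
    have "0 \<le> (U *v axis i 1) \<bullet> (A *v (U *v axis i 1))" using assms by (simp add: psd_iff)
    also have "\<dots> = d i" unfolding A sandwich_axis[OF U] by (simp add: unitary_inner[OF U] inner_axis_self)
    finally show ?thesis .
  qed
  then show thesis using that U A by blast
qed

lemma gram_entry: "(adj B ** B) $ i $ j = cdot (\<chi> r. B $ r $ i) (\<chi> r. B $ r $ j)"
  by (simp add: cdot_def adj_def matrix_matrix_mult_def)

lemma psd_adj_mult_self: "psd (adj A ** A)"
  by (simp add: psd_iff hermitian_def adj_mult matrix_vector_mul_assoc[symmetric] inner_matrix[of _ "adj A"])

text \<open>
  For \<open>A\<^sup>* A = U E U\<^sup>*\<close> the columns \<open>b\<^sub>i\<close> of \<open>A U\<close> are orthogonal with squared lengths \<open>e\<^sub>i\<close>. Normalising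
  the nonzero ones and completing them to an orthonormal basis gives the columns of \<open>W\<close>. The completion
  makes \<open>W\<close> unitary even for singular \<open>A\<close>.
\<close>

theorem singular_value_decomposition:
  fixes A :: "complex^'n^'n"
  obtains W U d where "unitary W" "unitary U" "\<And>i. 0 \<le> d i" "A = W ** real_diag d ** adj U"
proof -
  obtain U e where U: "unitary U" and e: "adj A ** A = U ** real_diag e ** adj U" "\<And>i. 0 \<le> e i"
    using psd_diagonalization[OF psd_adj_mult_self[of A]] by blast
  define b where "b i = (\<chi> r. (A ** U) $ r $ i)" for i
  have "adj (A ** U) ** (A ** U) = adj U ** (adj A ** A) ** U"
    by (simp add: adj_mult matrix_mul_assoc)
  also have "\<dots> = real_diag e"
    unfolding e(1) using U by (simp add: matrix_mul_assoc[symmetric] unitary_cancel)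
  finally have gram: "adj (A ** U) ** (A ** U) = real_diag e" .
  have bb: "cdot (b i) (b j) = (if i = j then complex_of_real (e i) else 0)" for i j
  proof -
    have "cdot (b i) (b j) = (adj (A ** U) ** (A ** U)) $ i $ j"
      by (simp add: b_def gram_entry)
    then show ?thesis by (simp add: gram real_diag_def)
  qed
  define v where "v i = (1 / sqrt (e i)) *\<^sub>R b i" for i
  have vv: "cdot (v i) (v j) = of_real (1 / sqrt (e i)) * of_real (1 / sqrt (e j)) * cdot (b i) (b j)" for i j
    using cdot_commute[of "v i" "b j"] cdot_commute[of "b i" "b j"]
    by (simp add: v_def cdot_scaleR)
  have "orthonormal_on {i. e i \<noteq> 0} v"
    unfolding orthonormal_on_def vv bb using e(2)
    by (auto simp: of_real_mult[symmetric] simp del: of_real_mult)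
  then obtain w where w: "orthonormal_on UNIV w" "\<And>i. e i \<noteq> 0 \<Longrightarrow> w i = v i"
    using orthonormal_on_extend[of "{i. e i \<noteq> 0}" v] by auto
  define W where "W = (\<chi> r c. w c $ r)"
  have "sqrt (e i) *\<^sub>R w i = b i" for i
  proof (cases "e i = 0")
    case True
    then have "b i = 0" using bb[of i i] by (simp add: cdot_self)
    then show ?thesis using True by simp
  next
    case False
    then show ?thesis using w(2)[of i] e(2)[of i] by (simp add: v_def)
  qed
  then have "sqrt (e i) *\<^sub>R w i $ r = b i $ r" for i r
    by (metis vector_scaleR_component)
  then have "W ** real_diag (\<lambda>i. sqrt (e i)) = A ** U"
    unfolding vec_eq_iff real_diag_mult_right
    by (simp add: W_def b_def scaleR_conv_of_real[where 'a=complex] mult.commute)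
  then have "A = W ** real_diag (\<lambda>i. sqrt (e i)) ** adj U"
    by (metis U matrix_mul_assoc matrix_mul_rid unitary_cancel(1))
  moreover have "unitary W" unfolding W_def by (rule orthonormal_family_unitary[OF w(1)])
  ultimately show thesis using that[of W U "\<lambda>i. sqrt (e i)"] U e(2) by simp
qed

lemma mat_abs_svd:
  assumes "unitary W" "unitary U" "\<And>i. 0 \<le> d i"
  shows "mat_abs (W ** real_diag d ** adj U) = U ** real_diag d ** adj U"
proof -
  have "adj (W ** real_diag d ** adj U) ** (W ** real_diag d ** adj U) = U ** real_diag (\<lambda>i. d i * d i) ** adj U"
    by (simp add: adj_sandwich sandwich_mult assms)
  then show ?thesis
    unfolding mat_abs_def using hfun_eq[OF assms(2), of _ "\<lambda>i. d i * d i" sqrt] assms(3) by simp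
qed

section \<open>Square roots of positive semidefinite matrices\<close>

lemma psd_sqrt:
  assumes "psd A"
  shows "psd (hfun sqrt A)" "hfun sqrt A ** hfun sqrt A = A"
proof -
  obtain U d where U: "unitary U" and A: "A = U ** real_diag d ** adj U" "\<And>i. 0 \<le> d i"
    using psd_diagonalization[OF assms] by blast
  have S: "hfun sqrt A = U ** real_diag (\<lambda>i. sqrt (d i)) ** adj U" by (rule hfun_eq[OF U A(1)])
  show "psd (hfun sqrt A)" unfolding S by (rule psd_sandwich) (simp add: A(2))
  show "hfun sqrt A ** hfun sqrt A = A" unfolding S sandwich_mult[OF U] using A by simp
qed

lemma psd_invertible_inverse_sqrt:
  assumes "psd A" "invertible A"
  defines "S \<equiv> hfun sqrt A" and "T \<equiv> hfun (\<lambda>t. 1 / sqrt t) A"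
  shows "S ** T = mat 1" "T ** S = mat 1" "hermitian T"
proof -
  obtain U d where U: "unitary U" and A: "A = U ** real_diag d ** adj U" and d0: "\<And>i. 0 \<le> d i"
    using psd_diagonalization[OF assms(1)] by blast
  have d: "d i > 0" for i
  proof (rule ccontr)
    assume "\<not> d i > 0"
    then have "d i = 0" using d0[of i] by simp
    then have "A *v (U *v axis i 1) = 0" unfolding A sandwich_axis[OF U] by simp
    moreover obtain B where "B ** A = mat 1" using assms(2) by (auto simp: invertible_def)
    ultimately have "U *v axis i 1 = 0"
      by (metis matrix_vector_mul_assoc matrix_vector_mul_lid matrix_vector_mult_0_right)
    then have "(axis i 1 :: complex^'a) \<bullet> axis i 1 = 0"
      using unitary_inner[OF U, of "axis i 1" "axis i 1"] by simp
    then show False by (simp add: inner_axis_self)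
  qed
  have S: "S = U ** real_diag (\<lambda>i. sqrt (d i)) ** adj U" unfolding S_def by (rule hfun_eq[OF U A])
  have T: "T = U ** real_diag (\<lambda>i. 1 / sqrt (d i)) ** adj U"
    unfolding T_def by (rule hfun_eq[OF U A])
  have one: "U ** real_diag (\<lambda>i. 1) ** adj U = mat 1"
    using real_diag_const[of 1, where 'a='a] U by (simp add: unitary_cancel)
  have "sqrt (d i) \<noteq> 0" for i using d[of i] by simp
  then show "S ** T = mat 1" "T ** S = mat 1"
    unfolding S T sandwich_mult[OF U] by (simp_all add: one)
  show "hermitian T" unfolding T by (rule hermitian_sandwich)
qed

text \<open>
  The square root is operator monotone: the hypothesis says \<open>N\<^sup>2 \<le> K\<^sup>2\<close>. If \<open>K - N\<close> had an eigenvector \<open>v\<close>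
  with eigenvalue \<open>d < 0\<close>, then \<open>N v = K v - d v\<close> with \<open>\<langle>v, K v\<rangle> \<ge> 0\<close> would be strictly longer than \<open>K v\<close>.
\<close>

lemma hermitian_le_of_norm_le:
  assumes N: "hermitian N" and K: "psd K"
    and le: "\<And>y. (N *v y) \<bullet> (N *v y) \<le> (K *v y) \<bullet> (K *v y)"
  shows "N \<preceq>\<^sub>L K"
proof -
  have herm: "hermitian (K - N)" using N K by (simp add: psd_def hermitian_def adj_diff)
  obtain U d where U: "unitary U" and KN: "K - N = U ** real_diag d ** adj U"
    using hermitian_diagonalization[OF herm] .
  have "0 \<le> d i" for i
  proof (rule ccontr)
    assume neg: "\<not> 0 \<le> d i"
    define v where "v = U *v axis i 1"
    have v1: "v \<bullet> v = 1" by (simp add: v_def unitary_inner[OF U] inner_axis_self)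
    have "(K - N) *v v = d i *\<^sub>R v"
      unfolding KN v_def by (rule sandwich_axis[OF U])
    then have "N *v v = K *v v - d i *\<^sub>R v"
      by (simp add: matrix_vector_mult_diff_rdistrib algebra_simps)
    then have "(N *v v) \<bullet> (N *v v) = (K *v v) \<bullet> (K *v v) - 2 * d i * (v \<bullet> (K *v v)) + (d i)\<^sup>2"
      using v1 by (simp add: inner_diff_left inner_diff_right inner_commute power2_eq_square)
    moreover have "0 \<le> v \<bullet> (K *v v)" using K by (simp add: psd_iff)
    then have "2 * d i * (v \<bullet> (K *v v)) \<le> 0" using neg by (simp add: mult_nonpos_nonneg)
    moreover have "(d i)\<^sup>2 > 0" using neg by simp
    ultimately show False using le[of v] by linarith
  qed
  then have "psd (K - N)" unfolding KN by (rule psd_sandwich)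
  then show ?thesis using N K by (simp add: loewner_le_def psd_def)
qed

section \<open>Positive block matrices and the geometric mean\<close>

text \<open>
  For Hermitian \<open>A\<close> and \<open>B\<close>: positivity of the two-by-two block matrix with rows \<open>(A, X)\<close> and \<open>(X\<^sup>*, B)\<close>, expressed by its
  quadratic form at the block vector \<open>(x, y)\<close>, in which the two off-diagonal terms have the same real part.
\<close>

definition block_pos :: "complex^'n^'n \<Rightarrow> complex^'n^'n \<Rightarrow> complex^'n^'n \<Rightarrow> bool" where
  "block_pos A X B \<longleftrightarrow> (\<forall>x y. 0 \<le> x \<bullet> (A *v x) + 2 * (x \<bullet> (X *v y)) + y \<bullet> (B *v y))"

lemma loewner_le_inner:
  assumes "A \<preceq>\<^sub>L B"
  shows "x \<bullet> (A *v x) \<le> x \<bullet> (B *v x)"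
proof -
  have "0 \<le> x \<bullet> ((B - A) *v x)" using assms by (simp add: loewner_le_def psd_iff)
  then show ?thesis by (simp add: matrix_vector_mult_diff_rdistrib inner_diff_right)
qed

lemma loewner_leI:
  assumes "hermitian A" "hermitian B" "\<And>x. x \<bullet> (A *v x) \<le> x \<bullet> (B *v x)"
  shows "A \<preceq>\<^sub>L B"
  using assms
  by (simp add: loewner_le_def psd_iff hermitian_def adj_diff matrix_vector_mult_diff_rdistrib inner_diff_right)

lemma block_pos_mono:
  assumes "block_pos A X B" "A \<preceq>\<^sub>L A'" "B \<preceq>\<^sub>L B'"
  shows "block_pos A' X B'"
  unfolding block_pos_def
proof (intro allI)
  fix x y
  have "0 \<le> x \<bullet> (A *v x) + 2 * (x \<bullet> (X *v y)) + y \<bullet> (B *v y)"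
    using assms(1) by (simp add: block_pos_def)
  then show "0 \<le> x \<bullet> (A' *v x) + 2 * (x \<bullet> (X *v y)) + y \<bullet> (B' *v y)"
    using loewner_le_inner[OF assms(2), of x] loewner_le_inner[OF assms(3), of y] by linarith
qed

lemma block_pos_swap:
  assumes "hermitian M" "block_pos A M B"
  shows "block_pos B M A"
  unfolding block_pos_def
proof (intro allI)
  fix x y
  have "x \<bullet> (M *v y) = y \<bullet> (M *v x)"
    using hermitian_inner[OF assms(1), of x y] by (simp add: inner_commute)
  moreover have "0 \<le> y \<bullet> (A *v y) + 2 * (y \<bullet> (M *v x)) + x \<bullet> (B *v x)"
    using assms(2) by (simp add: block_pos_def)
  ultimately show "0 \<le> x \<bullet> (B *v x) + 2 * (x \<bullet> (M *v y)) + y \<bullet> (A *v y)"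
    by simp
qed

text \<open>
  If \<open>T = A\<^sup>-\<^sup>1\<^sup>/\<^sup>2\<close> and \<open>N = T X T\<close>, block positivity becomes \<open>N\<^sup>* N \<le> T B T\<close>. For Hermitian \<open>X\<close> this
  bounds \<open>N\<close> by \<open>(T B T)\<^sup>1\<^sup>/\<^sup>2\<close>; for \<open>B = A\<close> it says that \<open>N\<close> is a contraction.
\<close>

lemma block_pos_normalize:
  assumes "block_pos A X B" and T: "hermitian T" "T ** A ** T = mat 1"
  shows "((T ** X ** T) *v y) \<bullet> ((T ** X ** T) *v y) \<le> y \<bullet> ((T ** B ** T) *v y)"
proof -
  define w where "w = (T ** X ** T) *v y"
  have sym: "(T *v u) \<bullet> v = u \<bullet> (T *v v)" for u v by (rule hermitian_inner[OF T(1)])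
  \<comment> \<open>completing the square: this is the minimiser over the first component\<close>
  have "0 \<le> (T *v (- w)) \<bullet> (A *v (T *v (- w))) + 2 * ((T *v (- w)) \<bullet> (X *v (T *v y)))
      + (T *v y) \<bullet> (B *v (T *v y))"
    using assms(1) by (simp only: block_pos_def)
  also have "\<dots> = (- w) \<bullet> ((T ** A ** T) *v (- w)) + 2 * ((- w) \<bullet> w) + y \<bullet> ((T ** B ** T) *v y)"
    by (simp only: sym w_def matrix_vector_mul_assoc matrix_mul_assoc)
  also have "\<dots> = y \<bullet> ((T ** B ** T) *v y) - w \<bullet> w"
    by (simp add: T(2))
  finally show ?thesis by (simp add: w_def)
qed

lemma inverse_sqrt_normalizes:
  assumes "S ** S = A" "S ** T = mat 1" "T ** S = mat 1"
  shows "T ** A ** T = mat 1"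
proof -
  have "T ** A ** T = (T ** S) ** (S ** T)" by (simp add: assms(1)[symmetric] matrix_mul_assoc)
  then show ?thesis by (simp add: assms)
qed

lemma psd_conjugate:
  assumes "psd A"
  shows "psd (C ** A ** adj C)"
proof -
  have "hermitian (C ** A ** adj C)"
    using assms by (simp add: psd_def hermitian_def adj_mult matrix_mul_assoc)
  moreover have "x \<bullet> ((C ** A ** adj C) *v x) = (adj C *v x) \<bullet> (A *v (adj C *v x))" for x
    by (simp add: matrix_vector_mul_assoc[symmetric] inner_matrix)
  ultimately show ?thesis using assms by (simp add: psd_iff)
qed

text \<open>
  With \<open>S = A\<^sup>1\<^sup>/\<^sup>2\<close>, \<open>T = S\<^sup>-\<^sup>1\<close> and \<open>K = (T B T)\<^sup>1\<^sup>/\<^sup>2\<close>, the mean is \<open>S K S\<close>. Its block form is the square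
  \<open>|S x + K S y|\<^sup>2\<close>. It is maximal because \<open>(T M T)\<^sup>2 \<le> K\<^sup>2\<close> for every competitor \<open>M\<close>, and
  taking square roots preserves the order.
\<close>

lemma geo_mean_inv_maximal:
  assumes A: "psd A" "invertible A" and B: "psd B"
  shows "hermitian (geo_mean_inv A B)" "block_pos A (geo_mean_inv A B) B"
    and "\<And>M. hermitian M \<Longrightarrow> block_pos A M B \<Longrightarrow> M \<preceq>\<^sub>L geo_mean_inv A B"
proof -
  define S where "S = hfun sqrt A"
  define T where "T = hfun (\<lambda>t. 1 / sqrt t) A"
  define K where "K = hfun sqrt (T ** B ** T)"
  have F: "geo_mean_inv A B = S ** K ** S"
    by (simp add: geo_mean_inv_def S_def T_def K_def Let_def)
  have S: "psd S" "S ** S = A" unfolding S_def by (rule psd_sqrt[OF A(1)])+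
  have hS: "hermitian S" using S(1) by (simp add: psd_def)
  have T: "S ** T = mat 1" "T ** S = mat 1" "hermitian T"
    unfolding S_def T_def by (rule psd_invertible_inverse_sqrt[OF A])+
  have "psd (T ** B ** T)" using psd_conjugate[OF B, of T] T(3) by (simp add: hermitian_def)
  then have K: "psd K" "K ** K = T ** B ** T" unfolding K_def by (rule psd_sqrt)+
  have hK: "hermitian K" using K(1) by (simp add: psd_def)
  have TS: "T *v (S *v x) = x" for x by (simp add: matrix_vector_mul_assoc T)
  have sym: "(S *v u) \<bullet> v = u \<bullet> (S *v v)" "(K *v u) \<bullet> v = u \<bullet> (K *v v)"
    "(T *v u) \<bullet> v = u \<bullet> (T *v v)" for u v
    by (rule hermitian_inner[OF hS] hermitian_inner[OF hK] hermitian_inner[OF T(3)])+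
  have KK: "(K *v u) \<bullet> (K *v u) = u \<bullet> ((T ** B ** T) *v u)" for u
    by (simp add: sym K(2)[symmetric] matrix_vector_mul_assoc[symmetric])
  show herm: "hermitian (geo_mean_inv A B)"
    using hS hK by (simp add: F hermitian_def adj_mult matrix_mul_assoc)
  show "block_pos A (geo_mean_inv A B) B"
    unfolding block_pos_def
  proof (intro allI)
    fix x y
    have "y \<bullet> (B *v y) = (T *v (S *v y)) \<bullet> (B *v (T *v (S *v y)))" by (simp add: TS)
    also have "\<dots> = (K *v (S *v y)) \<bullet> (K *v (S *v y))"
      by (simp only: KK) (simp only: sym matrix_vector_mul_assoc[symmetric])
    finally have y: "y \<bullet> (B *v y) = (K *v (S *v y)) \<bullet> (K *v (S *v y))" .
    have x: "x \<bullet> (A *v x) = (S *v x) \<bullet> (S *v x)"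
      by (simp add: S(2)[symmetric] sym matrix_vector_mul_assoc[symmetric])
    have "x \<bullet> (geo_mean_inv A B *v y) = (S *v x) \<bullet> (K *v (S *v y))"
      by (simp add: F sym matrix_vector_mul_assoc[symmetric])
    then have "x \<bullet> (A *v x) + 2 * (x \<bullet> (geo_mean_inv A B *v y)) + y \<bullet> (B *v y)
        = (S *v x + K *v (S *v y)) \<bullet> (S *v x + K *v (S *v y))"
      unfolding x y by (simp add: inner_add_left inner_add_right inner_commute)
    then show "0 \<le> x \<bullet> (A *v x) + 2 * (x \<bullet> (geo_mean_inv A B *v y)) + y \<bullet> (B *v y)"
      by simp
  qed
  show "M \<preceq>\<^sub>L geo_mean_inv A B" if M: "hermitian M" "block_pos A M B" for M
  proof -
    define N where "N = T ** M ** T"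
    have "hermitian N" using M(1) T(3) by (simp add: N_def hermitian_def adj_mult matrix_mul_assoc)
    moreover have "(N *v y) \<bullet> (N *v y) \<le> (K *v y) \<bullet> (K *v y)" for y
      unfolding KK N_def
      by (rule block_pos_normalize[OF M(2) T(3) inverse_sqrt_normalizes[OF S(2) T(1,2)]])
    ultimately have NK: "N \<preceq>\<^sub>L K" by (rule hermitian_le_of_norm_le[OF _ K(1)])
    have "x \<bullet> (M *v x) \<le> x \<bullet> (geo_mean_inv A B *v x)" for x
    proof -
      have "x \<bullet> (M *v x) = (T *v (S *v x)) \<bullet> (M *v (T *v (S *v x)))" by (simp add: TS)
      also have "\<dots> = (S *v x) \<bullet> (N *v (S *v x))"
        by (simp only: N_def sym matrix_vector_mul_assoc[symmetric])
      also have "\<dots> \<le> (S *v x) \<bullet> (K *v (S *v x))" by (rule loewner_le_inner[OF NK])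
      also have "\<dots> = x \<bullet> (geo_mean_inv A B *v x)"
        by (simp only: F sym matrix_vector_mul_assoc[symmetric])
      finally show ?thesis .
    qed
    then show ?thesis by (rule loewner_leI[OF M(1) herm])
  qed
qed

lemma psd_add_mat:
  assumes "psd A" "0 < (e::real)"
  shows "psd (A + mat (complex_of_real e))" "invertible (A + mat (complex_of_real e))"
proof -
  have q: "x \<bullet> ((A + mat (complex_of_real e)) *v x) = x \<bullet> (A *v x) + e * (x \<bullet> x)" for x
    by (simp add: matrix_vector_mult_add_rdistrib mat_real_vec inner_add_right)
  show "psd (A + mat (complex_of_real e))"
    unfolding psd_iff q using assms by (auto simp: psd_iff hermitian_def adj_add)
  have "x = 0" if "(A + mat (complex_of_real e)) *v x = 0" for x
  proof -
    have "0 \<le> x \<bullet> (A *v x)" using assms(1) by (simp add: psd_iff)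
    moreover have "x \<bullet> (A *v x) + e * (x \<bullet> x) = 0" using q[of x] that by simp
    moreover have "0 \<le> e * (x \<bullet> x)" using assms(2) by simp
    ultimately have "e * (x \<bullet> x) = 0" by linarith
    then show ?thesis using assms(2) by simp
  qed
  then show "invertible (A + mat (complex_of_real e))"
    using matrix_left_invertible_ker[of "A + mat (complex_of_real e)"] invertible_left_inverse by blast
qed

lemma add_mat_mono:
  assumes "hermitian A" "d \<le> e"
  shows "A + mat (complex_of_real d) \<preceq>\<^sub>L A + mat (complex_of_real e)"
  using assms
  by (intro loewner_leI)
     (auto simp: hermitian_def adj_add matrix_vector_mult_add_rdistrib mat_real_vec inner_add_right
           intro!: mult_right_mono)

lemma mono_bounded_tendsto_at_right_0:
  fixes q :: "real \<Rightarrow> real"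
  assumes mono: "\<And>d e. 0 < d \<Longrightarrow> d \<le> e \<Longrightarrow> q d \<le> q e" and bd: "\<And>e. 0 < e \<Longrightarrow> m \<le> q e"
  shows "\<exists>l. (q \<longlongrightarrow> l) (at_right 0)"
proof -
  define l where "l = Inf (q ` {0<..})"
  have bdd: "bdd_below (q ` {0<..})" using bd by (auto intro!: bdd_belowI[of _ m])
  have "(q \<longlongrightarrow> l) (at_right 0)"
  proof (rule decreasing_tendsto)
    show "\<forall>\<^sub>F e in at_right 0. l \<le> q e"
      using eventually_at_right_less[of 0] by eventually_elim (auto simp: l_def intro!: cInf_lower bdd)
    fix x assume "l < x"
    then obtain e where e: "e > 0" "q e < x"
      unfolding l_def using cInf_lessD[of "q ` {0<..}" x] by auto
    show "\<forall>\<^sub>F d in at_right 0. q d < x"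
      using eventually_at_right_real[OF e(1)]
    proof eventually_elim
      case (elim d)
      then have "q d \<le> q e" by (intro mono) auto
      then show ?case using e(2) by simp
    qed
  qed
  then show ?thesis by blast
qed

lemma hermitian_polarization:
  assumes "hermitian F"
  shows "x \<bullet> (F *v y) = ((x + y) \<bullet> (F *v (x + y)) - (x - y) \<bullet> (F *v (x - y))) / 4"
  using hermitian_inner[OF assms, of x y]
  by (simp add: matrix_vector_right_distrib matrix_vector_mult_diff_distrib inner_add_left inner_add_right
      inner_diff_left inner_diff_right inner_commute)

lemma matrix_entry_inner:
  "F $ i $ j = Complex (axis i 1 \<bullet> (F *v axis j 1)) (axis i \<i> \<bullet> (F *v axis j 1))"
  for F :: "complex^'n^'n"
proof -
  have "(F *v axis j 1) $ i = F $ i $ j"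
    by (simp add: matrix_vector_mult_def axis_def if_distrib[of "\<lambda>x. _ * x"] cong: if_cong)
  then show ?thesis by (simp add: inner_axis' inner_complex_def complex_eq_iff)
qed

text \<open>
  Monotone convergence for Hermitian matrices. Each quadratic form converges as a monotone bounded real
  function, polarization passes this to all \<open>\<langle>x, F(e) y\<rangle>\<close>, and these determine the entries.
\<close>

lemma hermitian_monotone_tendsto:
  fixes F :: "real \<Rightarrow> complex^'n^'n"
  assumes herm: "\<And>e. 0 < e \<Longrightarrow> hermitian (F e)"
    and mono: "\<And>d e. 0 < d \<Longrightarrow> d \<le> e \<Longrightarrow> F d \<preceq>\<^sub>L F e"
    and bd: "\<And>e. 0 < e \<Longrightarrow> M \<preceq>\<^sub>L F e"
  obtains L where "(F \<longlongrightarrow> L) (at_right 0)" "M \<preceq>\<^sub>L L"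
proof -
  have quad: "\<exists>l. ((\<lambda>e. x \<bullet> (F e *v x)) \<longlongrightarrow> l) (at_right 0)" for x
    by (rule mono_bounded_tendsto_at_right_0[of _ "x \<bullet> (M *v x)"])
       (use loewner_le_inner mono bd in blast)+
  have "\<exists>l. ((\<lambda>e. x \<bullet> (F e *v y)) \<longlongrightarrow> l) (at_right 0)" for x y
  proof -
    obtain k l where kl: "((\<lambda>e. (x + y) \<bullet> (F e *v (x + y))) \<longlongrightarrow> k) (at_right 0)"
      "((\<lambda>e. (x - y) \<bullet> (F e *v (x - y))) \<longlongrightarrow> l) (at_right 0)"
      using quad by metis
    have "((\<lambda>e. ((x + y) \<bullet> (F e *v (x + y)) - (x - y) \<bullet> (F e *v (x - y))) / 4)
        \<longlongrightarrow> (k - l) / 4) (at_right 0)"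
      by (intro tendsto_intros kl) simp
    moreover have "\<forall>\<^sub>F e in at_right 0. ((x + y) \<bullet> (F e *v (x + y)) - (x - y) \<bullet> (F e *v (x - y))) / 4
        = x \<bullet> (F e *v y)"
      using eventually_at_right_less[of 0]
      by eventually_elim (rule hermitian_polarization[OF herm, symmetric])
    ultimately have "((\<lambda>e. x \<bullet> (F e *v y)) \<longlongrightarrow> (k - l) / 4) (at_right 0)"
      by (rule Lim_transform_eventually)
    then show ?thesis by blast
  qed
  then obtain b where b: "\<And>x y. ((\<lambda>e. x \<bullet> (F e *v y)) \<longlongrightarrow> b x y) (at_right 0)" by metis
  define L where "L = (\<chi> i j. Complex (b (axis i 1) (axis j 1)) (b (axis i \<i>) (axis j 1)))"
  have "((\<lambda>e. F e $ i $ j) \<longlongrightarrow> L $ i $ j) (at_right 0)" for i j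
    unfolding matrix_entry_inner[of "F _"] L_def vec_lambda_beta by (intro tendsto_Complex b)
  then have L: "(F \<longlongrightarrow> L) (at_right 0)" by (intro vec_tendstoI)
  have "((\<lambda>e. adj (F e)) \<longlongrightarrow> adj L) (at_right 0)"
    unfolding adj_def by (intro vec_tendstoI) (simp, intro tendsto_intros L)
  moreover have "\<forall>\<^sub>F e in at_right 0. adj (F e) = F e"
    using eventually_at_right_less[of 0] by eventually_elim (use herm in \<open>simp add: hermitian_def\<close>)
  ultimately have "(F \<longlongrightarrow> adj L) (at_right 0)" by (rule Lim_transform_eventually)
  then have hL: "hermitian L"
    unfolding hermitian_def using L tendsto_unique trivial_limit_at_right_real by metis
  have "x \<bullet> (M *v x) \<le> x \<bullet> (L *v x)" for x
  proof (rule tendsto_lowerbound)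
    have "((\<lambda>e. (F e *v x) $ i) \<longlongrightarrow> (L *v x) $ i) (at_right 0)" for i
      unfolding matrix_vector_mult_def vec_lambda_beta
      by (intro tendsto_sum tendsto_mult tendsto_const tendsto_vec_nth L)
    then show "((\<lambda>e. x \<bullet> (F e *v x)) \<longlongrightarrow> x \<bullet> (L *v x)) (at_right 0)"
      by (intro tendsto_inner tendsto_const vec_tendstoI)
    show "\<forall>\<^sub>F e in at_right 0. x \<bullet> (M *v x) \<le> x \<bullet> (F e *v x)"
      using eventually_at_right_less[of 0] by eventually_elim (rule loewner_le_inner[OF bd])
  qed simp
  moreover have "hermitian M" using bd[of 1] by (simp add: loewner_le_def)
  ultimately have "M \<preceq>\<^sub>L L" by (intro loewner_leI hL)
  with L show thesis by (rule that)
qed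

text \<open>
  For singular arguments the mean is defined by a limit, which has to be shown to exist. By
  maximality the regularised means decrease with \<open>e\<close>, and they all dominate \<open>M\<close>, so
  they converge to a limit that still dominates \<open>M\<close>.
\<close>

theorem block_pos_le_geo_mean:
  assumes A: "psd A" and B: "psd B" and M: "hermitian M" "block_pos A M B"
  shows "M \<preceq>\<^sub>L A \<sharp> B"
proof (cases "invertible A \<and> invertible B")
  case True
  then show ?thesis using geo_mean_inv_maximal(3)[OF A _ B M] by (simp add: geo_mean_def)
next
  case False
  define F where "F e = geo_mean_inv (A + mat (complex_of_real e)) (B + mat (complex_of_real e))" for e
  have hAB: "hermitian A" "hermitian B" using A B by (simp_all add: psd_def)
  have max: "hermitian (F e)" "block_pos (A + mat (complex_of_real e)) (F e) (B + mat (complex_of_real e))"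
    "\<And>X. hermitian X \<Longrightarrow> block_pos (A + mat (complex_of_real e)) X (B + mat (complex_of_real e)) \<Longrightarrow> X \<preceq>\<^sub>L F e"
    if "0 < e" for e
    unfolding F_def
    by (rule geo_mean_inv_maximal[OF psd_add_mat[OF A that] psd_add_mat(1)[OF B that]]; assumption)+
  have mono: "F d \<preceq>\<^sub>L F e" if "0 < d" "d \<le> e" for d e
  proof -
    have "block_pos (A + mat (complex_of_real e)) (F d) (B + mat (complex_of_real e))"
      using block_pos_mono[OF max(2)[OF that(1)] add_mat_mono[OF hAB(1) that(2)] add_mat_mono[OF hAB(2) that(2)]] .
    moreover have "0 < e" using that by simp
    ultimately show ?thesis using max(3)[OF _ max(1)[OF that(1)]] by simp
  qed
  have bd: "M \<preceq>\<^sub>L F e" if "0 < e" for e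
  proof -
    have "A \<preceq>\<^sub>L A + mat (complex_of_real e)" "B \<preceq>\<^sub>L B + mat (complex_of_real e)"
      using that add_mat_mono[OF hAB(1), of 0 e] add_mat_mono[OF hAB(2), of 0 e] by simp_all
    then show ?thesis using max(3)[OF that M(1) block_pos_mono[OF M(2)]] by simp
  qed
  obtain L where L: "(F \<longlongrightarrow> L) (at_right 0)" "M \<preceq>\<^sub>L L"
    using hermitian_monotone_tendsto[of F M, OF max(1) mono bd] by blast
  have "A \<sharp> B = Lim (at_right 0) F" using False by (auto simp: geo_mean_def F_def[abs_def])
  also have "\<dots> = L" by (rule tendsto_Lim[OF _ L(1)]) simp
  finally show ?thesis using L(2) by simp
qed

section \<open>Positive maps and contractions\<close>

lemma positive_map_add: "positive_linear_map \<Phi> \<Longrightarrow> \<Phi> (A + B) = \<Phi> A + \<Phi> B"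
  and positive_map_cscale: "positive_linear_map \<Phi> \<Longrightarrow> \<Phi> (cscale c A) = cscale c (\<Phi> A)"
  and positive_map_psd: "positive_linear_map \<Phi> \<Longrightarrow> psd A \<Longrightarrow> psd (\<Phi> A)"
  by (simp_all add: positive_linear_map_def linear_cscale_iff)

lemma positive_map_scaleR: "positive_linear_map \<Phi> \<Longrightarrow> \<Phi> (r *\<^sub>R A) = r *\<^sub>R \<Phi> A"
  using positive_map_cscale[of \<Phi> "complex_of_real r" A] by (simp add: cscale_real)

lemma positive_map_sum:
  assumes "positive_linear_map \<Phi>" "finite I"
  shows "\<Phi> (\<Sum>i\<in>I. F i) = (\<Sum>i\<in>I. \<Phi> (F i))"
  using assms(2)
proof (induction I rule: finite_induct)
  case empty
  then show ?case using positive_map_scaleR[OF assms(1), of 0 0] by simp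
next
  case (insert i I)
  then show ?case by (simp add: positive_map_add[OF assms(1)])
qed

lemma sum_matrix_vec: "(\<Sum>i\<in>I. F i) *v x = (\<Sum>i\<in>I. F i *v x)"
  for F :: "'i \<Rightarrow> complex^'n^'m"
  by (induction I rule: infinite_finite_induct) (simp_all add: matrix_vector_mult_add_rdistrib)

lemma positive_map_conjugate:
  assumes "positive_linear_map \<Phi>"
  shows "positive_linear_map (\<lambda>X. \<Phi> (S ** X ** adj S))"
  using assms
  by (simp add: positive_linear_map_def linear_cscale_iff matrix_mult_add_left matrix_mult_add_right
      cscale_mult_left cscale_mult_right psd_conjugate)

text \<open>
  Since \<open>|c| = 1\<close>, replacing \<open>y\<close> by \<open>c y\<close> leaves the form of \<open>R\<close> unchanged, and the block form at \<open>(x, y)\<close> becomes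
  that of \<open>R\<close> at \<open>x + c y\<close>.
\<close>

lemma block_pos_scalar:
  assumes R: "psd R" and c: "cmod c = 1"
  shows "block_pos R (cscale c R) R"
  unfolding block_pos_def
proof (intro allI)
  fix x y
  have comm: "R *v (c *s y) = c *s (R *v y)"
    by (simp add: matrix_vector_mult_def vec_eq_iff sum_distrib_left mult_ac)
  have "cdot (c *s y) (c *s z) = (cnj c * c) * cdot y z" for z
    by (simp add: cdot_def sum_distrib_left mult_ac)
  then have y: "(c *s y) \<bullet> (R *v (c *s y)) = y \<bullet> (R *v y)"
    using complex_norm_square[of c] c by (simp add: inner_eq_Re_cdot comm mult.commute)
  have "x \<bullet> (R *v x) + 2 * (x \<bullet> (cscale c R *v y)) + y \<bullet> (R *v y)
      = (x + c *s y) \<bullet> (R *v (x + c *s y))"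
    using hermitian_inner[of R x "c *s y"] R unfolding y[symmetric] cscale_vec
    by (simp add: psd_def matrix_vector_right_distrib inner_add_left inner_add_right inner_commute)
  also have "0 \<le> \<dots>" using R by (simp add: psd_iff)
  finally show "0 \<le> x \<bullet> (R *v x) + 2 * (x \<bullet> (cscale c R *v y)) + y \<bullet> (R *v y)" .
qed

lemma block_pos_sum:
  assumes "\<And>i. i \<in> I \<Longrightarrow> block_pos (A i) (X i) (B i)"
  shows "block_pos (\<Sum>i\<in>I. A i) (\<Sum>i\<in>I. X i) (\<Sum>i\<in>I. B i)"
  unfolding block_pos_def
proof (intro allI)
  fix x y
  have "0 \<le> (\<Sum>i\<in>I. x \<bullet> (A i *v x) + 2 * (x \<bullet> (X i *v y)) + y \<bullet> (B i *v y))"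
    using assms by (intro sum_nonneg) (simp add: block_pos_def)
  then show "0 \<le> x \<bullet> ((\<Sum>i\<in>I. A i) *v x) + 2 * (x \<bullet> ((\<Sum>i\<in>I. X i) *v y)) + y \<bullet> ((\<Sum>i\<in>I. B i) *v y)"
    by (simp add: sum_matrix_vec inner_sum_right sum.distrib sum_distrib_left)
qed

text \<open>
  The Hermitian matrices \<open>A = (Y + Y\<^sup>*) / 2\<close> and \<open>B = (Y - Y\<^sup>*) / 2i\<close> commute and satisfy \<open>A\<^sup>2 + B\<^sup>2 = I\<close>.
  A joint diagonalization therefore gives \<open>Y = A + i B\<close> the eigenvalues \<open>c\<^sub>k = a\<^sub>k + i b\<^sub>k\<close> of modulus one, and
  the \<open>P\<^sub>k\<close> are the projections onto the joint eigenvectors.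
\<close>

lemma unitary_spectral_resolution:
  fixes Y :: "complex^'n^'n"
  assumes Y: "unitary Y"
  obtains P c where "\<And>k::'n. psd (P k)" "\<And>k. cmod (c k) = 1"
    "(\<Sum>k\<in>UNIV. P k) = mat 1" "Y = (\<Sum>k\<in>UNIV. cscale (c k) (P k))"
proof -
  define A where "A = (1/2) *\<^sub>R (Y + adj Y)"
  define B where "B = cscale (- \<i> / 2) (Y - adj Y)"
  have YY: "Y ** adj Y = adj Y ** Y" "adj Y ** Y = mat 1" using Y by (simp_all add: unitary_def)
  have A: "hermitian A"
    by (simp add: A_def hermitian_def adj_add adj_cscale add.commute flip: cscale_real)
  have B: "hermitian B"
    by (simp add: B_def hermitian_def adj_diff adj_cscale) (simp add: cscale_def vec_eq_iff algebra_simps)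
  have AB: "A ** B = B ** A"
    unfolding A_def B_def
    by (simp add: cscale_mult_left cscale_mult_right matrix_mult_add_left matrix_mult_add_right
        matrix_mult_diff_left matrix_mult_diff_right YY flip: cscale_real)
       (simp add: cscale_def vec_eq_iff algebra_simps)
  have sq: "A ** A + B ** B = mat 1"
    unfolding A_def B_def
    by (simp add: cscale_mult_left cscale_mult_right matrix_mult_add_left matrix_mult_add_right
        matrix_mult_diff_left matrix_mult_diff_right YY flip: cscale_real)
       (simp add: cscale_def vec_eq_iff algebra_simps)
  obtain U a b where U: "unitary U" and a: "A = U ** real_diag a ** adj U"
    and b: "B = U ** real_diag b ** adj U"
    by (rule commuting_hermitian_diagonalization[OF A B AB])
  define P where "P k = U ** real_diag (\<lambda>i. if i = k then 1 else 0) ** adj U" for k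
  define c where "c k = Complex (a k) (b k)" for k
  have entry: "(U ** real_diag d ** adj U) $ i $ j
      = (\<Sum>k\<in>UNIV. U $ i $ k * complex_of_real (d k) * cnj (U $ j $ k))" for d i j
    by (simp add: matrix_matrix_mult_def[of "U ** real_diag d"] real_diag_mult_right adj_def)
  have Pentry: "P k $ i $ j = U $ i $ k * cnj (U $ j $ k)" for k i j
    by (simp add: P_def entry if_distrib[of "\<lambda>x. _ * complex_of_real x * _"] cong: if_cong)
  have diag: "real_diag (\<lambda>i. a i * a i) + real_diag (\<lambda>i. b i * b i) = mat 1"
  proof -
    have "U ** (real_diag (\<lambda>i. a i * a i) + real_diag (\<lambda>i. b i * b i)) ** adj U = mat 1"
      using sq unfolding a b sandwich_mult[OF U] by (simp add: matrix_mult_add_left matrix_mult_add_right)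
    then have "adj U ** (U ** (real_diag (\<lambda>i. a i * a i) + real_diag (\<lambda>i. b i * b i)) ** adj U) ** U
        = adj U ** mat 1 ** U" by simp
    then show ?thesis by (simp add: matrix_mul_assoc[symmetric] unitary_cancel[OF U])
  qed
  have ab: "a k * a k + b k * b k = 1" for k
  proof -
    have "(real_diag (\<lambda>i. a i * a i) + real_diag (\<lambda>i. b i * b i)) $ k $ k = (mat 1 :: complex^'n^'n) $ k $ k"
      by (simp add: diag)
    then have "complex_of_real (a k * a k + b k * b k) = 1"
      by (simp add: real_diag_def mat_def)
    then show ?thesis by (metis of_real_eq_1_iff)
  qed
  have 1: "psd (P k)" for k unfolding P_def by (rule psd_sandwich) simp
  have 2: "cmod (c k) = 1" for k using ab[of k] by (simp add: c_def cmod_def power2_eq_square)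
  have "(\<Sum>k\<in>UNIV. P k) = U ** real_diag (\<lambda>i. 1) ** adj U"
    by (simp add: vec_eq_iff Pentry entry)
  then have 3: "(\<Sum>k\<in>UNIV. P k) = mat 1"
    using real_diag_const[of 1, where 'a='n] by (simp add: unitary_cancel[OF U])
  have "Y = A + cscale \<i> B"
    by (simp add: A_def B_def flip: cscale_real) (simp add: cscale_def vec_eq_iff algebra_simps)
  also have "\<dots> = (\<Sum>k\<in>UNIV. cscale (c k) (P k))"
  proof -
    have ck: "c k = complex_of_real (a k) + \<i> * complex_of_real (b k)" for k
      by (simp add: c_def complex_eq_iff)
    have "(A + cscale \<i> B) $ i $ j = (\<Sum>k\<in>UNIV. c k * P k $ i $ j)" for i j
    proof -
      have "(A + cscale \<i> B) $ i $ j = A $ i $ j + \<i> * B $ i $ j" by (simp add: cscale_def)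
      also have "\<dots> = (\<Sum>k\<in>UNIV. U $ i $ k * complex_of_real (a k) * cnj (U $ j $ k)
          + \<i> * (U $ i $ k * complex_of_real (b k) * cnj (U $ j $ k)))"
        unfolding a b entry sum_distrib_left sum.distrib ..
      also have "\<dots> = (\<Sum>k\<in>UNIV. c k * P k $ i $ j)"
        by (rule sum.cong) (simp_all add: ck Pentry algebra_simps)
      finally show ?thesis .
    qed
    then show ?thesis by (simp add: vec_eq_iff cscale_def)
  qed
  finally have 4: "Y = (\<Sum>k\<in>UNIV. cscale (c k) (P k))" .
  show thesis by (rule that[OF 1 2 3 4])
qed

lemma positive_map_unitary:
  fixes Y :: "complex^'n^'n"
  assumes \<Phi>: "positive_linear_map \<Phi>" and uY: "unitary Y"
  shows "block_pos (\<Phi> (mat 1)) (\<Phi> Y) (\<Phi> (mat 1))"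
proof -
  obtain P c where P: "\<And>k::'n. psd (P k)" and c: "\<And>k. cmod (c k) = 1"
    and P1: "(\<Sum>k\<in>UNIV. P k) = mat 1" and Y: "Y = (\<Sum>k\<in>UNIV. cscale (c k) (P k))"
    by (rule unitary_spectral_resolution[OF uY]) (rule that; assumption)
  have "block_pos (\<Sum>k\<in>UNIV. \<Phi> (P k)) (\<Sum>k\<in>UNIV. cscale (c k) (\<Phi> (P k))) (\<Sum>k\<in>UNIV. \<Phi> (P k))"
    by (intro block_pos_sum block_pos_scalar positive_map_psd[OF \<Phi>] P c)
  moreover have "\<Phi> (mat 1) = (\<Sum>k\<in>UNIV. \<Phi> (P k))"
    unfolding P1[symmetric] by (simp add: positive_map_sum[OF \<Phi>])
  moreover have "\<Phi> Y = (\<Sum>k\<in>UNIV. cscale (c k) (\<Phi> (P k)))"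
    unfolding Y by (simp add: positive_map_sum[OF \<Phi>] positive_map_cscale[OF \<Phi>])
  ultimately show ?thesis by simp
qed

lemma unitary_of_commuting_hermitian:
  assumes "hermitian H" "hermitian K" "H ** K = K ** H" "H ** H + K ** K = mat 1"
  shows "unitary (H + cscale \<i> K)"
proof -
  have "adj (H + cscale \<i> K) = H + cscale (- \<i>) K"
    using assms by (simp add: adj_add adj_cscale hermitian_def)
  moreover have "(H + cscale (- \<i>) K) ** (H + cscale \<i> K) = H ** H + K ** K"
    "(H + cscale \<i> K) ** (H + cscale (- \<i>) K) = H ** H + K ** K"
    by (simp_all add: cscale_mult_left cscale_mult_right matrix_mult_add_left matrix_mult_add_right assms(3))
       (simp_all add: cscale_def vec_eq_iff algebra_simps)
  ultimately show ?thesis using assms(4) by (simp add: unitary_def)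
qed

text \<open>
  For singular values \<open>s = cos \<theta>\<close> one has \<open>s = (e\<^sup>i\<^sup>\<theta> + e\<^sup>-\<^sup>i\<^sup>\<theta>) / 2\<close>. Accordingly the positive factor \<open>H\<close>
  in \<open>C = V H\<close> is the average of the unitaries \<open>H \<plusminus> i K\<close> with \<open>K = (I - H\<^sup>2)\<^sup>1\<^sup>/\<^sup>2\<close>.
\<close>

lemma contraction_average_of_unitaries:
  fixes C :: "complex^'n^'n"
  assumes "\<And>y. (C *v y) \<bullet> (C *v y) \<le> y \<bullet> y"
  obtains Y1 Y2 where "unitary Y1" "unitary Y2" "C = (1/2) *\<^sub>R (Y1 + Y2)"
proof -
  obtain W U s where W: "unitary W" and U: "unitary U" and s0: "\<And>i. 0 \<le> s i"
    and C: "C = W ** real_diag s ** adj U"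
    using singular_value_decomposition[of C] by metis
  have s1: "(s i)\<^sup>2 \<le> 1" for i
    using assms[of "U *v axis i 1"] unfolding C sandwich_axis[OF U]
    by (simp add: unitary_inner[OF U] unitary_inner[OF W] inner_axis_self power2_eq_square)
  define V where "V = W ** adj U"
  define H where "H = U ** real_diag s ** adj U"
  define K where "K = U ** real_diag (\<lambda>i. sqrt (1 - (s i)\<^sup>2)) ** adj U"
  have V: "unitary V" unfolding V_def by (intro unitary_mult W unitary_adj U)
  have hHK: "hermitian H" "hermitian K" unfolding H_def K_def by (rule hermitian_sandwich)+
  have HK: "H ** K = K ** H" unfolding H_def K_def sandwich_mult[OF U] by (simp add: mult.commute)
  have "H ** H + K ** K = U ** (real_diag (\<lambda>i. s i * s i) + real_diag (\<lambda>i. 1 - (s i)\<^sup>2)) ** adj U"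
    unfolding H_def K_def sandwich_mult[OF U]
    using s1 by (simp add: matrix_mult_add_left matrix_mult_add_right)
  also have "real_diag (\<lambda>i. s i * s i) + real_diag (\<lambda>i. 1 - (s i)\<^sup>2) = mat 1"
    by (simp add: vec_eq_iff real_diag_def mat_def power2_eq_square)
  finally have "H ** H + K ** K = mat 1" by (simp add: unitary_cancel[OF U])
  then have E: "unitary (H + cscale \<i> K)" by (rule unitary_of_commuting_hermitian[OF hHK HK])
  have E': "unitary (H + cscale (- \<i>) K)"
    using unitary_adj[OF E] hHK by (simp add: adj_add adj_cscale hermitian_def)
  have "C = V ** H"
    unfolding C V_def H_def using U by (simp add: matrix_mul_assoc[symmetric] unitary_cancel)
  also have "\<dots> = (1/2) *\<^sub>R (V ** (H + cscale \<i> K) + V ** (H + cscale (- \<i>) K))"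
    by (simp add: matrix_mult_add_right cscale_mult_right flip: cscale_real)
       (simp add: cscale_def vec_eq_iff algebra_simps)
  finally show thesis by (rule that[OF unitary_mult[OF V E] unitary_mult[OF V E']])
qed

lemma positive_map_contraction:
  assumes \<Phi>: "positive_linear_map \<Phi>" and C: "\<And>y. (C *v y) \<bullet> (C *v y) \<le> y \<bullet> y"
  shows "block_pos (\<Phi> (mat 1)) (\<Phi> C) (\<Phi> (mat 1))"
proof -
  obtain Y1 Y2 where Y: "unitary Y1" "unitary Y2" and CY: "C = (1/2) *\<^sub>R (Y1 + Y2)"
    by (rule contraction_average_of_unitaries[OF C])
  show ?thesis
    unfolding block_pos_def
  proof (intro allI)
    fix x y
    have "x \<bullet> (\<Phi> C *v y) = (1/2) * (x \<bullet> (\<Phi> Y1 *v y) + x \<bullet> (\<Phi> Y2 *v y))"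
      by (simp add: CY positive_map_scaleR[OF \<Phi>] positive_map_add[OF \<Phi>] scaleR_matrix_vec
          matrix_vector_mult_add_rdistrib inner_add_right del: scaleR_add_right)
    moreover have "0 \<le> x \<bullet> (\<Phi> (mat 1) *v x) + 2 * (x \<bullet> (\<Phi> Y1 *v y)) + y \<bullet> (\<Phi> (mat 1) *v y)"
      "0 \<le> x \<bullet> (\<Phi> (mat 1) *v x) + 2 * (x \<bullet> (\<Phi> Y2 *v y)) + y \<bullet> (\<Phi> (mat 1) *v y)"
      using positive_map_unitary[OF \<Phi> Y(1)] positive_map_unitary[OF \<Phi> Y(2)] by (simp_all add: block_pos_def)
    ultimately show "0 \<le> x \<bullet> (\<Phi> (mat 1) *v x) + 2 * (x \<bullet> (\<Phi> C *v y)) + y \<bullet> (\<Phi> (mat 1) *v y)"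
      by simp
  qed
qed

text \<open>
  The map \<open>X \<mapsto> \<Phi>(S X S)\<close> with \<open>S = J\<^sup>1\<^sup>/\<^sup>2\<close> is again positive; it sends \<open>I\<close> to \<open>\<Phi>(J)\<close> and the contraction
  \<open>S\<^sup>-\<^sup>1 Z S\<^sup>-\<^sup>1\<close> to \<open>\<Phi>(Z)\<close>.
\<close>

lemma positive_map_block_pos_invertible:
  assumes \<Phi>: "positive_linear_map \<Phi>" and J: "psd J" "invertible J" and b: "block_pos J Z J"
  shows "block_pos (\<Phi> J) (\<Phi> Z) (\<Phi> J)"
proof -
  define S where "S = hfun sqrt J"
  define T where "T = hfun (\<lambda>t. 1 / sqrt t) J"
  have S: "psd S" "S ** S = J" unfolding S_def by (rule psd_sqrt[OF J(1)])+
  have T: "S ** T = mat 1" "T ** S = mat 1" "hermitian T"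
    unfolding S_def T_def by (rule psd_invertible_inverse_sqrt[OF J])+
  have TJT: "T ** J ** T = mat 1" by (rule inverse_sqrt_normalizes[OF S(2) T(1,2)])
  have aS: "adj S = S" using S(1) by (simp add: psd_def hermitian_def)
  have "block_pos (\<Phi> (S ** mat 1 ** adj S)) (\<Phi> (S ** (T ** Z ** T) ** adj S)) (\<Phi> (S ** mat 1 ** adj S))"
  proof (rule positive_map_contraction[OF positive_map_conjugate[OF \<Phi>]])
    fix y show "(T ** Z ** T *v y) \<bullet> (T ** Z ** T *v y) \<le> y \<bullet> y"
      using block_pos_normalize[OF b T(3) TJT, of y] by (simp add: TJT)
  qed
  moreover have "S ** (T ** Z ** T) ** adj S = (S ** T) ** Z ** (T ** S)"
    unfolding aS by (simp only: matrix_mul_assoc)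
  ultimately show ?thesis by (simp add: aS S(2) T)
qed

text \<open>
  For singular \<open>J\<close>, apply the invertible case to \<open>J + e I\<close>: the block form at \<open>(x, y)\<close> then is
  the affine function \<open>q + e r\<close> of \<open>e > 0\<close>, whose limit at \<open>0\<close> is the form \<open>q\<close> for \<open>J\<close>.
\<close>

theorem positive_map_block_pos:
  assumes \<Phi>: "positive_linear_map \<Phi>" and J: "psd J" and b: "block_pos J Z J"
  shows "block_pos (\<Phi> J) (\<Phi> Z) (\<Phi> J)"
  unfolding block_pos_def
proof (intro allI)
  fix x y
  define r where "r = x \<bullet> (\<Phi> (mat 1) *v x) + y \<bullet> (\<Phi> (mat 1) *v y)"
  define q where "q = x \<bullet> (\<Phi> J *v x) + 2 * (x \<bullet> (\<Phi> Z *v y)) + y \<bullet> (\<Phi> J *v y)"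
  have le: "0 \<le> q + e * r" if e: "0 < e" for e
  proof -
    have hJ: "hermitian J" using J by (simp add: psd_def)
    have "J \<preceq>\<^sub>L J + mat (complex_of_real e)"
      using add_mat_mono[OF hJ, of 0 e] e by simp
    then have "block_pos (J + mat (complex_of_real e)) Z (J + mat (complex_of_real e))"
      using block_pos_mono[OF b] by blast
    from positive_map_block_pos_invertible[OF \<Phi> psd_add_mat[OF J e] this]
    have "0 \<le> x \<bullet> (\<Phi> (J + mat (complex_of_real e)) *v x) + 2 * (x \<bullet> (\<Phi> Z *v y))
        + y \<bullet> (\<Phi> (J + mat (complex_of_real e)) *v y)"
      by (simp add: block_pos_def)
    moreover have "\<Phi> (J + mat (complex_of_real e)) = \<Phi> J + e *\<^sub>R \<Phi> (mat 1)"
    proof -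
      have "mat (complex_of_real e) = e *\<^sub>R (mat 1 :: complex^'a^'a)"
        by (simp add: cscale_def mat_def vec_eq_iff flip: cscale_real)
      then show ?thesis by (simp add: positive_map_add[OF \<Phi>] positive_map_scaleR[OF \<Phi>])
    qed
    ultimately show ?thesis
      by (simp add: q_def r_def matrix_vector_mult_add_rdistrib scaleR_matrix_vec inner_add_right algebra_simps)
  qed
  have "((\<lambda>e. q + e * r) \<longlongrightarrow> q + 0 * r) (at_right 0)" by (intro tendsto_intros)
  moreover have "\<forall>\<^sub>F e in at_right 0. 0 \<le> q + e * r"
    using eventually_at_right_less[of 0] by eventually_elim (rule le)
  ultimately have "0 \<le> q + 0 * r" by (rule tendsto_lowerbound) simp
  then show "0 \<le> x \<bullet> (\<Phi> J *v x) + 2 * (x \<bullet> (\<Phi> Z *v y)) + y \<bullet> (\<Phi> J *v y)" by (simp add: q_def)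
qed

section \<open>Block matrices formed with the modulus\<close>

text \<open>
  In the coordinates \<open>a = W\<^sup>* x\<close> and \<open>b = U\<^sup>* y\<close> the block form splits into the forms
  \<open>p |a|\<^sup>2 + 2 d \<langle>a, b\<rangle> + q |b|\<^sup>2\<close>, each at least \<open>(p\<^sup>1\<^sup>/\<^sup>2 |a| - q\<^sup>1\<^sup>/\<^sup>2 |b|)\<^sup>2\<close>.
\<close>

lemma block_pos_svd:
  assumes "\<And>i. 0 \<le> p i" "\<And>i. 0 \<le> q i" "\<And>i. p i * q i = (d i)\<^sup>2"
  shows "block_pos (W ** real_diag p ** adj W) (W ** real_diag d ** adj U) (U ** real_diag q ** adj U)"
  unfolding block_pos_def
proof (intro allI)
  fix x y
  have "0 \<le> p i * (a \<bullet> a) + 2 * (d i * (a \<bullet> b)) + q i * (b \<bullet> b)" for i and a b :: complex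
  proof -
    have "\<bar>d i\<bar> = sqrt (p i) * sqrt (q i)"
      by (simp add: assms(3) real_sqrt_mult[symmetric])
    then have "\<bar>d i * (a \<bullet> b)\<bar> \<le> sqrt (p i) * sqrt (q i) * (norm a * norm b)"
      using Cauchy_Schwarz_ineq2[of a b] by (simp add: abs_mult mult_left_mono assms)
    moreover have "0 \<le> (sqrt (p i) * norm a - sqrt (q i) * norm b)\<^sup>2" by simp
    ultimately show ?thesis
      using assms(1,2) by (simp add: power2_diff power_mult_distrib dot_square_norm mult_ac)
  qed
  then have "0 \<le> (\<Sum>i\<in>UNIV. p i * ((adj W *v x) $ i \<bullet> (adj W *v x) $ i)
      + 2 * (d i * ((adj W *v x) $ i \<bullet> (adj U *v y) $ i)) + q i * ((adj U *v y) $ i \<bullet> (adj U *v y) $ i))"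
    by (intro sum_nonneg)
  then show "0 \<le> x \<bullet> ((W ** real_diag p ** adj W) *v x) + 2 * (x \<bullet> ((W ** real_diag d ** adj U) *v y))
      + y \<bullet> ((U ** real_diag q ** adj U) *v y)"
    unfolding inner_sandwich by (simp add: sum.distrib sum_distrib_left)
qed

text \<open>
  If \<open>Z = W D U\<^sup>*\<close>, then \<open>|Z| = U D U\<^sup>*\<close> and \<open>|Z\<^sup>*| = W D W\<^sup>*\<close>, so all three blocks are
  diagonal in the two bases given by \<open>W\<close> and \<open>U\<close>.
\<close>

lemma block_pos_of_factorization:
  fixes Z :: "complex^'n^'n"
  assumes fg: "\<forall>t\<ge>0. 0 \<le> f t \<and> 0 \<le> g t \<and> f t * g t = t\<^sup>2"
  shows "block_pos (hfun g (mat_abs (adj Z))) Z (hfun f (mat_abs Z))"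
proof -
  obtain W U d where W: "unitary W" and U: "unitary U" and d: "\<And>i. 0 \<le> d i"
    and Z: "Z = W ** real_diag d ** adj U"
    using singular_value_decomposition[of Z] by metis
  have "hfun f (mat_abs Z) = U ** real_diag (\<lambda>i. f (d i)) ** adj U"
    unfolding Z mat_abs_svd[OF W U d] by (rule hfun_eq[OF U refl])
  moreover have "hfun g (mat_abs (adj Z)) = W ** real_diag (\<lambda>i. g (d i)) ** adj W"
    unfolding Z adj_sandwich mat_abs_svd[OF U W d] by (rule hfun_eq[OF W refl])
  moreover have "block_pos (W ** real_diag (\<lambda>i. g (d i)) ** adj W) (W ** real_diag d ** adj U)
      (U ** real_diag (\<lambda>i. f (d i)) ** adj U)"
    using fg d by (intro block_pos_svd) (auto simp: mult.commute)
  ultimately show ?thesis by (simp add: Z)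
qed

text \<open>
  If \<open>X = W D U\<^sup>*\<close>, then \<open>V = U W\<^sup>*\<close> satisfies \<open>V X = |X|\<close>; substituting \<open>V\<^sup>* x\<close> for \<open>x\<close> makes
  the off-diagonal block \<open>|X|\<close>, which brings the maximality of the geometric mean into play.
\<close>

lemma block_pos_polar:
  fixes X A B :: "complex^'n^'n"
  assumes "block_pos A X B"
  obtains V where "unitary V" "hermitian (mat_abs X)" "block_pos (V ** A ** adj V) (mat_abs X) B"
proof -
  obtain W U d where W: "unitary W" and U: "unitary U" and d: "\<And>i. 0 \<le> d i"
    and X: "X = W ** real_diag d ** adj U"
    using singular_value_decomposition[of X] by metis
  define V where "V = U ** adj W"
  have V: "unitary V" unfolding V_def by (intro unitary_mult U unitary_adj W)
  have abs: "mat_abs X = U ** real_diag d ** adj U" unfolding X by (rule mat_abs_svd[OF W U d])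
  have VX: "V ** X = mat_abs X"
    unfolding abs unfolding X V_def using W by (simp add: matrix_mul_assoc[symmetric] unitary_cancel)
  have "block_pos (V ** A ** adj V) (mat_abs X) B"
    unfolding block_pos_def
  proof (intro allI)
    fix x y
    have "0 \<le> (adj V *v x) \<bullet> (A *v (adj V *v x)) + 2 * ((adj V *v x) \<bullet> (X *v y)) + y \<bullet> (B *v y)"
      using assms by (simp add: block_pos_def)
    also have "(adj V *v x) \<bullet> (A *v (adj V *v x)) = x \<bullet> ((V ** A ** adj V) *v x)"
      by (simp add: inner_matrix matrix_vector_mul_assoc[symmetric])
    also have "(adj V *v x) \<bullet> (X *v y) = x \<bullet> (mat_abs X *v y)"
      unfolding VX[symmetric] by (simp add: inner_matrix matrix_vector_mul_assoc[symmetric])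
    finally show "0 \<le> x \<bullet> ((V ** A ** adj V) *v x) + 2 * (x \<bullet> (mat_abs X *v y)) + y \<bullet> (B *v y)" .
  qed
  moreover have "hermitian (mat_abs X)" unfolding abs by (rule hermitian_sandwich)
  ultimately show thesis using that[OF V] by simp
qed

theorem theorem2p1:
  fixes Z J :: "complex^'n^'n"
    and \<Phi> :: "complex^'n^'n \<Rightarrow> complex^'m^'m"
    and f g :: "real \<Rightarrow> real"
  assumes "psd J"
    and "positive_linear_map \<Phi>"
    and "\<forall>t\<ge>0. 0 \<le> f t \<and> 0 \<le> g t \<and> f t * g t = t\<^sup>2"
    and "hfun f (mat_abs Z) \<preceq>\<^sub>L J"
    and "hfun g (mat_abs (adj Z)) \<preceq>\<^sub>L J"
  shows "\<exists>V::complex^'m^'m. unitary V \<and>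
           mat_abs (\<Phi> Z) \<preceq>\<^sub>L (\<Phi> J) \<sharp> (V ** \<Phi> J ** adj V)"
proof -
  have "block_pos J Z J"
    by (rule block_pos_mono[OF block_pos_of_factorization[OF assms(3)] assms(5,4)])
  then have "block_pos (\<Phi> J) (\<Phi> Z) (\<Phi> J)"
    by (rule positive_map_block_pos[OF assms(2,1)])
  then obtain V where V: "unitary V" "hermitian (mat_abs (\<Phi> Z))"
    "block_pos (V ** \<Phi> J ** adj V) (mat_abs (\<Phi> Z)) (\<Phi> J)"
    by (rule block_pos_polar)
  have J: "psd (\<Phi> J)" by (rule positive_map_psd[OF assms(2,1)])
  have "mat_abs (\<Phi> Z) \<preceq>\<^sub>L (\<Phi> J) \<sharp> (V ** \<Phi> J ** adj V)"
    by (rule block_pos_le_geo_mean[OF J psd_conjugate[OF J] V(2) block_pos_swap[OF V(2,3)]])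
  then show ?thesis using V(1) by blast
qed

end
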